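(* Let $L=L_\Phi$ be a strongly GMN Lagrangian. Then the set of unobstructed angles $\theta\in S^1$, i.e. the set of those $\theta$ for which the set $\mathfrak{C}_{L,\theta}$ of closed Stokes trees of $L$ at $\theta$ is empty, is dense in $S^1$.
   Context: **Spectral data.** Let $C$ be a compact Riemann surface, $D\subset C$ a nonempty finite subset, $\mathcal{K}_C$ the canonical sheaf, $( *D)$ denoting allowed poles in $D$. Fix a positive integer $K$. A spectral data is $\Phi=\bigoplus_{i=1}^K\Phi_i\in\bigoplus_{i=1}^K H^0(C,\mathcal{K}_C^{\otimes i}( *D))$. In a local coordinate $z$ with cotangent coordinate $\zeta$, write $\Phi_i=\phi_i(z)dz^{\otimes i}$; the spectral curve is $L_\Phi=\{(z,\zeta)\in T^*(C\setminus D): \zeta^K-\sum_{i=1}^K\phi_i\zeta^{K-i}=0\}$. A meromorphic Lagrangian is a holomorphic Lagrangian submanifold $L$ (1-dimensional smooth complex submanifold) of the form $L_\Phi$. Let $\pi:T^*C\to C$ be the projection, $\pi_L=\pi|_L$, $\lambda=\zeta\,dz$ the Liouville form, and $B(\Phi)\subset C$ the (finite) set of branching values of $\pi_L$ (also called turning points). A branching point is simple if its branching order is minimal. **Associated quadratic differential.** Over $C\setminus(D\cup B(\Phi))$ the sheets of $L$ are locally labelled $1,\dots,K$; let $\lambda_i$ be the pull-back of $\lambda$ by the $i$-th sheet. Unordered pairs $\{i,j\}$ of distinct sheets form a finite covering of $C\setminus(D\cup B(\Phi))$ carrying the quadratic differential $\lambda_{ij}=(\lambda_i-\lambda_j)^2$.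 Filling in the punctures over $B(\Phi)$ (by an unbranched disk if $\{i,j\}$ is the pair of sheets merging there, extending $\lambda_{ij}$ by zero; by a possibly branched disk otherwise) gives a finite branched covering $\widetilde C\to C\setminus D$ with a quadratic differential $\widetilde\Phi$. **Strongly GMN.** A quadratic differential is strongly GMN if: any branch point (of the projection of its spectral curve) is simple; it has at least one branch point; any pole has order $\ge 2$; it has at least one pole. $\Phi$ (equivalently $L=L_\Phi$) is strongly GMN if $\widetilde\Phi$ is strongly GMN and $\widetilde\Phi$ has poles on $D$ (at the points over $D$). **PreStokes curves.** Here $\theta\in S^1=\mathbb{R}/\mathbb{Z}$. A type structure of a smooth immersed curve $\gamma$ in $C\setminus D$ is an ordered pair $\mathfrak{t}=(s_1,s_2)$ of sections of $\gamma^*L$. The pair $(\gamma,(s_1,s_2))$ is a preStokes curve (at $\theta$) of type $(s_1,s_2)$ if $s_1,s_2$ do not pass branching points and $\mathrm{Im}(e^{-2\pi i\theta}(\lambda_1-\lambda_2))=0$ along $\gamma$, $\lambda_i=s_i^*\lambda$; it is oriented so that $\int\mathrm{Re}(e^{-2\pi i\theta}(\lambda_1-\lambda_2))$ increases. A branching value is of type $(s_1,s_2)$ (and also of type $(s_2,s_1)$) if it is a simple branching value at which the sheets $s_1,s_2$ merge. **Closed Stokes trees.** A tree is a connected acyclic graph whose interior vertices have valency $\ge3$; exterior vertices are those of valency one. A closed Stokes tree of $L$ at $\theta$ (4d BPS state of genus 0) is a finite tree $\mathcal{T}$ immersed in $C$, with a type structure $\mathfrak{t}_e$ on the interior of each edge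 $e$, such that: (1) each edge $e$ is a preStokes curve of type $\mathfrak{t}_e$; (2) each exterior vertex on an edge of type $\mathfrak{t}$ is at a branching value of type $\mathfrak{t}$; (3) every interior vertex lies in $C\setminus(D\cup B(\Phi))$; (4) at an interior vertex, if $e_1,\dots,e_k$ are the edges in the cyclic order induced from the orientation of $C$, there are sheets $s_1,\dots,s_k$ of $L$ such that each $e_i$ is a preStokes curve of type $(s_{i-1},s_i)$ up to replacing $(s_{i-1},s_i)$ by $(s_i,s_{i-1})$ (indices modulo $k$). Closed Stokes trees are considered up to reparametrization.
   Formalization: In condition (4) on interior vertices, the edges are oriented away from the vertex and the replacement of (s_{i-1},s_i) by (s_i,s_{i-1}) is made for all edges at that vertex simultaneously; with independent replacements the density claim can fail. *)

theory Defs
  imports "HOL-Complex_Analysis.Complex_Analysis"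
begin

section \<open>Riemann surfaces\<close>

type_synonym 'a chart = "'a set \<times> ('a \<Rightarrow> complex)"

abbreviation dom_of :: "'a chart \<Rightarrow> 'a set" where "dom_of c \<equiv> fst c"
abbreviation coord :: "'a chart \<Rightarrow> 'a \<Rightarrow> complex" where "coord c \<equiv> snd c"

definition chart_inv :: "'a chart \<Rightarrow> complex \<Rightarrow> 'a"
  where "chart_inv c = inv_into (dom_of c) (coord c)"

record 'a surface =
  surf_top :: "'a topology"
  atlas :: "'a chart set"

abbreviation points :: "'a surface \<Rightarrow> 'a set" where "points S \<equiv> topspace (surf_top S)"

text \<open>One-dimensional complex manifolds. They may be disconnected or empty: the surface of pairs
  of sheets below need not be connected. The atlas need not be maximal.\<close>

definition complex_curve :: "'a surface \<Rightarrow> bool" where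
  "complex_curve S \<longleftrightarrow>
     Hausdorff_space (surf_top S) \<and>
     \<Union> (dom_of ` atlas S) = points S \<and>
     (\<forall>c\<in>atlas S. openin (surf_top S) (dom_of c) \<and> open (coord c ` dom_of c) \<and>
        homeomorphic_map (subtopology (surf_top S) (dom_of c))
                         (top_of_set (coord c ` dom_of c)) (coord c)) \<and>
     (\<forall>c\<in>atlas S. \<forall>c'\<in>atlas S.
        (coord c' \<circ> chart_inv c) holomorphic_on (coord c ` (dom_of c \<inter> dom_of c')))"

definition compact_Riemann_surface :: "'a surface \<Rightarrow> bool" where
  "compact_Riemann_surface S \<longleftrightarrow>
     complex_curve S \<and> points S \<noteq> {} \<and> connected_space (surf_top S) \<and> compact_space (surf_top S)"

definition holomorphic_map :: "'a surface \<Rightarrow> 'b surface \<Rightarrow> ('a \<Rightarrow> 'b) \<Rightarrow> bool" where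
  "holomorphic_map X S p \<longleftrightarrow>
     continuous_map (surf_top X) (surf_top S) p \<and>
     (\<forall>d\<in>atlas X. \<forall>c\<in>atlas S.
        (coord c \<circ> p \<circ> chart_inv d) holomorphic_on (coord d ` {y \<in> dom_of d. p y \<in> dom_of c}))"


section \<open>Differentials and the cotangent bundle\<close>

text \<open>An element \<open>a dz\<^sup>i\<close> of the fibre of the \<open>i\<close>-th power of the canonical bundle at \<open>x\<close> is
  represented by the family of its coefficients \<open>a\<close> in all charts around \<open>x\<close>, set to zero on all
  other arguments. For \<open>i = 1\<close> these are the cotangent vectors at \<open>x\<close>.\<close>

type_synonym 'a coeffs = "'a chart \<Rightarrow> complex"

definition canonical_fibre :: "'a surface \<Rightarrow> nat \<Rightarrow> 'a \<Rightarrow> 'a coeffs set" where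
  "canonical_fibre S i x = {\<xi>.
     (\<forall>c\<in>atlas S. \<forall>c'\<in>atlas S. x \<in> dom_of c \<inter> dom_of c' \<longrightarrow>
        \<xi> c = \<xi> c' * deriv (coord c' \<circ> chart_inv c) (coord c x) ^ i) \<and>
     (\<forall>c. c \<notin> atlas S \<or> x \<notin> dom_of c \<longrightarrow> \<xi> c = 0)}"

text \<open>Sections over \<open>S\<close> of the \<open>i\<close>-th power of the canonical sheaf with arbitrary poles in \<open>D\<close>.
  The values of \<open>\<omega>\<close> at the points of \<open>D\<close> themselves carry no information.\<close>

definition meromorphic_differential ::
    "'a surface \<Rightarrow> 'a set \<Rightarrow> nat \<Rightarrow> ('a \<Rightarrow> 'a coeffs) \<Rightarrow> bool" where
  "meromorphic_differential S D i \<omega> \<longleftrightarrow>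
     (\<forall>x \<in> points S - D. \<omega> x \<in> canonical_fibre S i x) \<and>
     (\<forall>c\<in>atlas S.
        (\<lambda>w. \<omega> (chart_inv c w) c) holomorphic_on (coord c ` (dom_of c - D)) \<and>
        (\<lambda>w. \<omega> (chart_inv c w) c) meromorphic_on (coord c ` dom_of c))"

definition cotangent :: "'a surface \<Rightarrow> ('a \<times> 'a coeffs) set" where
  "cotangent S = {(x, \<xi>). x \<in> points S \<and> \<xi> \<in> canonical_fibre S 1 x}"

text \<open>Canonical coordinates \<open>(z, \<zeta>)\<close> on the cotangent bundle over a chart.\<close>

definition cot_coord :: "'a chart \<Rightarrow> 'a \<times> 'a coeffs \<Rightarrow> complex \<times> complex" where
  "cot_coord c = (\<lambda>(x, \<xi>). (coord c x, \<xi> c))"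

definition cot_open :: "'a surface \<Rightarrow> ('a \<times> 'a coeffs) set \<Rightarrow> bool" where
  "cot_open S W \<longleftrightarrow> W \<subseteq> cotangent S \<and>
     (\<forall>c\<in>atlas S. open (cot_coord c ` {p \<in> W. fst p \<in> dom_of c}))"

definition cot_top :: "'a surface \<Rightarrow> ('a \<times> 'a coeffs) topology" where
  "cot_top S = topology (cot_open S)"

lemma cot_coord_inj:
  assumes "complex_curve S" "c \<in> atlas S"
  shows "inj_on (cot_coord c) {p \<in> cotangent S. fst p \<in> dom_of c}"
proof (rule inj_onI, clarify)
  fix x \<xi> y \<eta>
  assume x: "(x, \<xi>) \<in> cotangent S" "fst (x, \<xi>) \<in> dom_of c"
    and y: "(y, \<eta>) \<in> cotangent S" "fst (y, \<eta>) \<in> dom_of c"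
    and eq: "cot_coord c (x, \<xi>) = cot_coord c (y, \<eta>)"
  have "homeomorphic_map (subtopology (surf_top S) (dom_of c))
          (top_of_set (coord c ` dom_of c)) (coord c)" "openin (surf_top S) (dom_of c)"
    using assms unfolding complex_curve_def by auto
  then have "inj_on (coord c) (dom_of c)"
    by (metis homeomorphic_imp_injective_map inf.absorb_iff2 openin_subset topspace_subtopology)
  then have xy: "x = y"
    using eq x y by (auto simp: cot_coord_def inj_on_def)
  have fibre: "\<xi> \<in> canonical_fibre S 1 x" "\<eta> \<in> canonical_fibre S 1 x"
    using x(1) y(1) xy by (simp_all add: cotangent_def)
  have coeff: "\<zeta> c' = (if c' \<in> atlas S \<and> x \<in> dom_of c'
      then \<zeta> c * deriv (coord c \<circ> chart_inv c') (coord c' x) ^ 1 else 0)"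
    if "\<zeta> \<in> canonical_fibre S 1 x" for \<zeta> c'
    using that[unfolded canonical_fibre_def mem_Collect_eq] x(2) assms(2)
    by (metis IntI fst_conv)
  have "\<xi> c = \<eta> c"
    using eq by (simp add: cot_coord_def)
  then have "\<xi> c' = \<eta> c'" for c'
    unfolding coeff[OF fibre(1), of c'] coeff[OF fibre(2), of c'] by simp
  then show "x = y \<and> \<xi> = \<eta>"
    using xy by auto
qed

lemma openin_cot_top:
  assumes "complex_curve S"
  shows "openin (cot_top S) = cot_open S"
proof -
  have "istopology (cot_open S)"
    unfolding istopology_def
  proof (intro conjI allI impI)
    fix V W assume V: "cot_open S V" and W: "cot_open S W"
    have "open (cot_coord c ` {p \<in> V \<inter> W. fst p \<in> dom_of c})" if c: "c \<in> atlas S" for c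
    proof -
      have "cot_coord c ` ({p \<in> V. fst p \<in> dom_of c} \<inter> {p \<in> W. fst p \<in> dom_of c}) =
            cot_coord c ` {p \<in> V. fst p \<in> dom_of c} \<inter> cot_coord c ` {p \<in> W. fst p \<in> dom_of c}"
        by (rule inj_on_image_Int[OF cot_coord_inj[OF assms c]])
           (use V W in \<open>auto simp: cot_open_def\<close>)
      moreover have "{p \<in> V \<inter> W. fst p \<in> dom_of c} =
          {p \<in> V. fst p \<in> dom_of c} \<inter> {p \<in> W. fst p \<in> dom_of c}"
        by auto
      ultimately show ?thesis
        using V W c by (auto simp: cot_open_def)
    qed
    then show "cot_open S (V \<inter> W)"
      using V by (auto simp: cot_open_def)
  next
    fix \<V> assume V: "\<forall>V\<in>\<V>. cot_open S V"
    have "open (cot_coord c ` {p \<in> \<Union>\<V>. fst p \<in> dom_of c})" if c: "c \<in> atlas S" for c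
    proof -
      have "cot_coord c ` {p \<in> \<Union>\<V>. fst p \<in> dom_of c} =
            (\<Union>V\<in>\<V>. cot_coord c ` {p \<in> V. fst p \<in> dom_of c})"
        by auto
      then show ?thesis
        using V c by (auto simp: cot_open_def)
    qed
    then show "cot_open S (\<Union>\<V>)"
      using V unfolding cot_open_def by blast
  qed
  then show ?thesis
    by (simp add: cot_top_def)
qed


section \<open>Spectral curves and branching points\<close>

definition spectral_data ::
    "'a surface \<Rightarrow> 'a set \<Rightarrow> nat \<Rightarrow> (nat \<Rightarrow> 'a \<Rightarrow> 'a coeffs) \<Rightarrow> bool" where
  "spectral_data S D K \<Phi> \<longleftrightarrow> (\<forall>i\<in>{1..K}. meromorphic_differential S D i (\<Phi> i))"

definition spectral_curve ::
    "'a surface \<Rightarrow> 'a set \<Rightarrow> nat \<Rightarrow> (nat \<Rightarrow> 'a \<Rightarrow> 'a coeffs) \<Rightarrow> ('a \<times> 'a coeffs) set" where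
  "spectral_curve S D K \<Phi> = {(x, \<xi>) \<in> cotangent S. x \<notin> D \<and>
     (\<forall>c\<in>atlas S. x \<in> dom_of c \<longrightarrow> \<xi> c ^ K - (\<Sum>i=1..K. \<Phi> i x c * \<xi> c ^ (K - i)) = 0)}"

text \<open>A regular holomorphic parametrization \<open>g\<close>, by a disk, of an open piece of \<open>L\<close> lying over
  the chart \<open>c\<close>; \<open>g\<close> is required to be a homeomorphism onto that piece.\<close>

definition local_parametrization ::
    "'a surface \<Rightarrow> ('a \<times> 'a coeffs) set \<Rightarrow> 'a chart \<Rightarrow> real \<Rightarrow> (complex \<Rightarrow> 'a \<times> 'a coeffs) \<Rightarrow> bool"
  where "local_parametrization S L c r g \<longleftrightarrow>
     c \<in> atlas S \<and> 0 < r \<and> (\<forall>w\<in>ball 0 r. fst (g w) \<in> dom_of c) \<and>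
     openin (subtopology (cot_top S) L) (g ` ball 0 r) \<and>
     homeomorphic_map (top_of_set (ball 0 r)) (subtopology (cot_top S) (g ` ball 0 r)) g \<and>
     (\<lambda>w. fst (cot_coord c (g w))) holomorphic_on ball 0 r \<and>
     (\<lambda>w. snd (cot_coord c (g w))) holomorphic_on ball 0 r \<and>
     (\<forall>w\<in>ball 0 r. deriv (\<lambda>w. fst (cot_coord c (g w))) w \<noteq> 0 \<or>
                    deriv (\<lambda>w. snd (cot_coord c (g w))) w \<noteq> 0)"

text \<open>One-dimensional complex submanifolds of the cotangent bundle. In a two-dimensional symplectic
  manifold these are automatically Lagrangian.\<close>

definition Lagrangian_submanifold :: "'a surface \<Rightarrow> ('a \<times> 'a coeffs) set \<Rightarrow> bool" where
  "Lagrangian_submanifold S L \<longleftrightarrow>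
     L \<subseteq> cotangent S \<and> (\<forall>p\<in>L. \<exists>c r g. local_parametrization S L c r g \<and> g 0 = p)"

text \<open>The branching order of the projection of \<open>L\<close> to the surface at \<open>p\<close> is \<open>n\<close>, i.e. the
  projection has the form \<open>w \<mapsto> w\<^sup>n\<close> in suitable local coordinates.\<close>

definition branching_order ::
    "'a surface \<Rightarrow> ('a \<times> 'a coeffs) set \<Rightarrow> 'a \<times> 'a coeffs \<Rightarrow> int \<Rightarrow> bool" where
  "branching_order S L p n \<longleftrightarrow> (\<exists>c r g. local_parametrization S L c r g \<and> g 0 = p \<and>
     n = zorder (\<lambda>w. fst (cot_coord c (g w)) - fst (cot_coord c (g 0))) 0)"

definition branching_points :: "'a surface \<Rightarrow> ('a \<times> 'a coeffs) set \<Rightarrow> ('a \<times> 'a coeffs) set" where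
  "branching_points S L = {p \<in> L. \<exists>n>1. branching_order S L p n}"

definition simple_branching_points ::
    "'a surface \<Rightarrow> ('a \<times> 'a coeffs) set \<Rightarrow> ('a \<times> 'a coeffs) set" where
  "simple_branching_points S L = {p \<in> L. branching_order S L p 2}"

definition branching_values :: "'a surface \<Rightarrow> ('a \<times> 'a coeffs) set \<Rightarrow> 'a set" where
  "branching_values S L = fst ` branching_points S L"


section \<open>Strongly GMN quadratic differentials\<close>

definition local_coeff :: "('a \<Rightarrow> 'a coeffs) \<Rightarrow> 'a chart \<Rightarrow> complex \<Rightarrow> complex" where
  "local_coeff q c = (\<lambda>w. q (chart_inv c w) c)"

definition pole_of :: "'a surface \<Rightarrow> ('a \<Rightarrow> 'a coeffs) \<Rightarrow> 'a \<Rightarrow> bool" where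
  "pole_of X q x \<longleftrightarrow> (\<exists>c\<in>atlas X. x \<in> dom_of c \<and> is_pole (local_coeff q c) (coord c x))"

definition order_of :: "'a surface \<Rightarrow> ('a \<Rightarrow> 'a coeffs) \<Rightarrow> 'a \<Rightarrow> int \<Rightarrow> bool" where
  "order_of X q x n \<longleftrightarrow>
     (\<exists>c\<in>atlas X. x \<in> dom_of c \<and> zorder (local_coeff q c) (coord c x) = n)"

text \<open>The spectral curve of \<open>q\<close> is \<open>{\<zeta>\<^sup>2 = q}\<close>, away from the poles of \<open>q\<close>. Its projection is branched
  over \<open>x\<close> iff the curve does not split into two holomorphic sections near \<open>x\<close>, i.e. iff \<open>q\<close> has no
  holomorphic square root near \<open>x\<close>. In particular zeros of even order, where the curve is a union
  of two unramified branches, are not branch points. Such zeros do occur in the construction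
  below: \<open>\<lambda>\<^sub>i\<^sub>j\<close> has a double zero in the coordinate \<open>w = z\<^bsup>1/2\<^esup>\<close> of the branched disk filling a
  puncture at which only one of the sheets \<open>i\<close>, \<open>j\<close> takes part in a simple branching.\<close>

definition qd_branch_point :: "'a surface \<Rightarrow> ('a \<Rightarrow> 'a coeffs) \<Rightarrow> 'a \<Rightarrow> bool" where
  "qd_branch_point X q x \<longleftrightarrow> x \<in> points X \<and> \<not> pole_of X q x \<and>
     \<not> (\<exists>c\<in>atlas X. x \<in> dom_of c \<and> (\<exists>r>0. \<exists>s. ball (coord c x) r \<subseteq> coord c ` dom_of c \<and>
          s holomorphic_on ball (coord c x) r \<and>
          (\<forall>w\<in>ball (coord c x) r. s w ^ 2 = local_coeff q c w)))"

text \<open>A branch point is simple if \<open>q\<close> vanishes to first order: then \<open>{\<zeta>\<^sup>2 = q}\<close> is smooth with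
  branching order two.\<close>

definition strongly_GMN_qd :: "'a surface \<Rightarrow> ('a \<Rightarrow> 'a coeffs) \<Rightarrow> bool" where
  "strongly_GMN_qd X q \<longleftrightarrow>
     (\<forall>x. qd_branch_point X q x \<longrightarrow> order_of X q x 1) \<and>
     (\<exists>x. qd_branch_point X q x) \<and>
     (\<forall>x\<in>points X. pole_of X q x \<longrightarrow> (\<exists>n\<le>-2. order_of X q x n)) \<and>
     (\<exists>x\<in>points X. pole_of X q x)"


section \<open>The associated quadratic differential\<close>

definition sheet_pairs ::
    "'a surface \<Rightarrow> 'a set \<Rightarrow> ('a \<times> 'a coeffs) set \<Rightarrow> ('a \<times> 'a coeffs set) set" where
  "sheet_pairs S D L = {(x, {\<xi>, \<eta>}) | x \<xi> \<eta>.
     x \<in> points S - D - branching_values S L \<and> (x, \<xi>) \<in> L \<and> (x, \<eta>) \<in> L \<and> \<xi> \<noteq> \<eta>}"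

text \<open>\<open>X\<close>, with projection \<open>p\<close>, is the covering of unordered pairs of distinct sheets of \<open>L\<close>,
  completed to a compact complex curve by filling the punctures over the branching values and over
  \<open>D\<close> by disks; \<open>\<sigma> y\<close> is the pair corresponding to a point \<open>y\<close> which is not one of the added ones.
  The last clause says that \<open>\<sigma>\<close> is locally given by two continuous sections of \<open>L\<close>, so that \<open>X\<close>
  carries the topology of the covering of pairs. Since a puncture of a complex curve can be filled
  in just one way, \<open>X\<close> is unique up to isomorphism, and the ramification of each filling disk is
  dictated by the monodromy of the pairs: a pair of sheets merging at a simple branching point is
  preserved and gives an unbranched disk.\<close>

definition pair_surface ::
    "'a surface \<Rightarrow> 'a set \<Rightarrow> ('a \<times> 'a coeffs) set \<Rightarrow> 'b surface \<Rightarrow> ('b \<Rightarrow> 'a) \<Rightarrow>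
     ('b \<Rightarrow> 'a coeffs set) \<Rightarrow> bool" where
  "pair_surface S D L X p \<sigma> \<longleftrightarrow>
     complex_curve X \<and> compact_space (surf_top X) \<and> holomorphic_map X S p \<and>
     finite {y \<in> points X. p y \<in> D \<union> branching_values S L} \<and>
     bij_betw (\<lambda>y. (p y, \<sigma> y))
       {y \<in> points X. p y \<notin> D \<union> branching_values S L} (sheet_pairs S D L) \<and>
     (\<forall>y \<in> points X. p y \<notin> D \<union> branching_values S L \<longrightarrow>
        (\<exists>U s\<^sub>1 s\<^sub>2. openin (surf_top X) U \<and> y \<in> U \<and>
           continuous_map (subtopology (surf_top X) U) (cot_top S) (\<lambda>u. (p u, s\<^sub>1 u)) \<and>
           continuous_map (subtopology (surf_top X) U) (cot_top S) (\<lambda>u. (p u, s\<^sub>2 u)) \<and>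
           (\<forall>u\<in>U. (p u, s\<^sub>1 u) \<in> L \<and> (p u, s\<^sub>2 u) \<in> L \<and> \<sigma> u = {s\<^sub>1 u, s\<^sub>2 u})))"

text \<open>The quadratic differential \<open>(\<lambda>\<^sub>i - \<lambda>\<^sub>j)\<^sup>2\<close>, pulled back along \<open>p\<close>. Its values over the branching
  values are those of the holomorphic extension; this extension vanishes at the points added for a
  merging pair.\<close>

definition associated_qd ::
    "'a surface \<Rightarrow> 'a set \<Rightarrow> ('a \<times> 'a coeffs) set \<Rightarrow> 'b surface \<Rightarrow> ('b \<Rightarrow> 'a) \<Rightarrow>
     ('b \<Rightarrow> 'a coeffs set) \<Rightarrow> ('b \<Rightarrow> 'b coeffs) \<Rightarrow> bool" where
  "associated_qd S D L X p \<sigma> q \<longleftrightarrow>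
     meromorphic_differential X {y \<in> points X. p y \<in> D} 2 q \<and>
     (\<forall>y \<in> points X. p y \<notin> D \<union> branching_values S L \<longrightarrow>
        (\<forall>\<xi> \<eta>. \<sigma> y = {\<xi>, \<eta>} \<longrightarrow>
           (\<forall>d\<in>atlas X. \<forall>c\<in>atlas S. y \<in> dom_of d \<and> p y \<in> dom_of c \<longrightarrow>
              q y d = ((\<xi> c - \<eta> c) * deriv (coord c \<circ> p \<circ> chart_inv d) (coord d y)) ^ 2)))"

text \<open>The carrier type \<^typ>\<open>'a \<times> nat\<close> is no restriction: the fibres of \<open>p\<close> are finite, so the points of
  \<open>X\<close> can always be written as pairs of a point of \<open>S\<close> and a number. "Has poles on \<open>D\<close>" is read as:
  every point over \<open>D\<close> is a pole.\<close>

definition strongly_GMN :: "'a surface \<Rightarrow> 'a set \<Rightarrow> ('a \<times> 'a coeffs) set \<Rightarrow> bool" where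
  "strongly_GMN S D L \<longleftrightarrow>
     (\<exists>(X :: ('a \<times> nat) surface) p \<sigma> q. pair_surface S D L X p \<sigma> \<and> associated_qd S D L X p \<sigma> q \<and>
        strongly_GMN_qd X q \<and> (\<forall>y\<in>points X. p y \<in> D \<longrightarrow> pole_of X q y))"


section \<open>PreStokes curves\<close>

definition smooth_on :: "real set \<Rightarrow> (real \<Rightarrow> complex) \<Rightarrow> bool" where
  "smooth_on I f \<longleftrightarrow> (\<exists>d :: nat \<Rightarrow> real \<Rightarrow> complex. d 0 = f \<and>
     (\<forall>n. \<forall>t\<in>I. (d n has_vector_derivative d (Suc n) t) (at t)))"

text \<open>Curves are parametrized by the open unit interval.\<close>

definition smooth_immersed_curve :: "'a surface \<Rightarrow> (real \<Rightarrow> 'a) \<Rightarrow> bool" where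
  "smooth_immersed_curve S \<gamma> \<longleftrightarrow>
     continuous_map (top_of_set {0<..<1}) (surf_top S) \<gamma> \<and>
     (\<forall>c\<in>atlas S. smooth_on {t\<in>{0<..<1}. \<gamma> t \<in> dom_of c} (coord c \<circ> \<gamma>) \<and>
        (\<forall>t\<in>{0<..<1}. \<gamma> t \<in> dom_of c \<longrightarrow> vector_derivative (coord c \<circ> \<gamma>) (at t) \<noteq> 0))"

definition section_along ::
    "'a surface \<Rightarrow> ('a \<times> 'a coeffs) set \<Rightarrow> (real \<Rightarrow> 'a) \<Rightarrow> (real \<Rightarrow> 'a coeffs) \<Rightarrow> bool" where
  "section_along S L \<gamma> s \<longleftrightarrow>
     continuous_map (top_of_set {0<..<1}) (cot_top S) (\<lambda>t. (\<gamma> t, s t)) \<and>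
     (\<forall>t\<in>{0<..<1}. (\<gamma> t, s t) \<in> L)"

text \<open>\<open>(\<lambda>\<^sub>1 - \<lambda>\<^sub>2)(\<gamma>'(t))\<close> computed in the chart \<open>c\<close>.\<close>

definition difference_form ::
    "'a chart \<Rightarrow> (real \<Rightarrow> 'a) \<Rightarrow> (real \<Rightarrow> 'a coeffs) \<Rightarrow> (real \<Rightarrow> 'a coeffs) \<Rightarrow> real \<Rightarrow> complex" where
  "difference_form c \<gamma> s\<^sub>1 s\<^sub>2 t = (s\<^sub>1 t c - s\<^sub>2 t c) * vector_derivative (coord c \<circ> \<gamma>) (at t)"

text \<open>The positivity of the real part expresses that \<open>\<gamma>\<close> is parametrized in the direction of its
  orientation. In particular the two sections are distinct.\<close>

definition preStokes_curve ::
    "'a surface \<Rightarrow> 'a set \<Rightarrow> ('a \<times> 'a coeffs) set \<Rightarrow> real \<Rightarrow> (real \<Rightarrow> 'a) \<Rightarrow>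
     (real \<Rightarrow> 'a coeffs) \<Rightarrow> (real \<Rightarrow> 'a coeffs) \<Rightarrow> bool" where
  "preStokes_curve S D L \<theta> \<gamma> s\<^sub>1 s\<^sub>2 \<longleftrightarrow>
     smooth_immersed_curve S \<gamma> \<and> (\<forall>t\<in>{0<..<1}. \<gamma> t \<in> points S - D) \<and>
     section_along S L \<gamma> s\<^sub>1 \<and> section_along S L \<gamma> s\<^sub>2 \<and>
     (\<forall>t\<in>{0<..<1}. (\<gamma> t, s\<^sub>1 t) \<notin> branching_points S L \<and> (\<gamma> t, s\<^sub>2 t) \<notin> branching_points S L) \<and>
     (\<forall>t\<in>{0<..<1}. \<forall>c\<in>atlas S. \<gamma> t \<in> dom_of c \<longrightarrow>
        Im (exp (- 2 * of_real pi * \<i> * of_real \<theta>) * difference_form c \<gamma> s\<^sub>1 s\<^sub>2 t) = 0 \<and>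
        Re (exp (- 2 * of_real pi * \<i> * of_real \<theta>) * difference_form c \<gamma> s\<^sub>1 s\<^sub>2 t) > 0)"


section \<open>Closed Stokes trees\<close>

text \<open>Each edge is directed from \<open>edge_src\<close> to \<open>edge_tgt\<close> and parametrized by the closed unit
  interval; the direction will be that of the preStokes curve. Different vertices may have the same
  position, as the tree is only immersed.\<close>

record 'a stokes_tree =
  tree_verts :: "nat set"
  tree_edges :: "nat set"
  edge_src :: "nat \<Rightarrow> nat"
  edge_tgt :: "nat \<Rightarrow> nat"
  vert_pos :: "nat \<Rightarrow> 'a"
  edge_path :: "nat \<Rightarrow> real \<Rightarrow> 'a"
  edge_sheet1 :: "nat \<Rightarrow> real \<Rightarrow> 'a coeffs"
  edge_sheet2 :: "nat \<Rightarrow> real \<Rightarrow> 'a coeffs"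

text \<open>A half-edge \<open>(e, True)\<close> is \<open>e\<close> traversed in its direction, \<open>(e, False)\<close> is \<open>e\<close> traversed
  backwards. A half-edge belongs to the vertex where it starts.\<close>

definition half_start :: "'a stokes_tree \<Rightarrow> nat \<times> bool \<Rightarrow> nat" where
  "half_start T h = (if snd h then edge_src T (fst h) else edge_tgt T (fst h))"

definition half_end :: "'a stokes_tree \<Rightarrow> nat \<times> bool \<Rightarrow> nat" where
  "half_end T h = (if snd h then edge_tgt T (fst h) else edge_src T (fst h))"

definition half_edges_at :: "'a stokes_tree \<Rightarrow> nat \<Rightarrow> (nat \<times> bool) set" where
  "half_edges_at T v = {h. fst h \<in> tree_edges T \<and> half_start T h = v}"

abbreviation valency :: "'a stokes_tree \<Rightarrow> nat \<Rightarrow> nat" where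
  "valency T v \<equiv> card (half_edges_at T v)"

definition connected_graph :: "'a stokes_tree \<Rightarrow> bool" where
  "connected_graph T \<longleftrightarrow> tree_verts T \<noteq> {} \<and>
     (\<forall>u\<in>tree_verts T. \<forall>v\<in>tree_verts T.
        (u, v) \<in> {(half_start T h, half_end T h) | h. fst h \<in> tree_edges T}\<^sup>*)"

text \<open>A cycle is a nonempty closed walk, of either direction on each edge, without repeated edges;
  loops and double edges are cycles.\<close>

definition graph_cycle :: "'a stokes_tree \<Rightarrow> (nat \<times> bool) list \<Rightarrow> bool" where
  "graph_cycle T hs \<longleftrightarrow> hs \<noteq> [] \<and> distinct (map fst hs) \<and> fst ` set hs \<subseteq> tree_edges T \<and>
     (\<forall>i<length hs. half_end T (hs ! i) = half_start T (hs ! (Suc i mod length hs)))"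

text \<open>The condition on valencies also excludes the tree consisting of a single vertex.\<close>

definition finite_tree :: "'a stokes_tree \<Rightarrow> bool" where
  "finite_tree T \<longleftrightarrow> finite (tree_verts T) \<and> finite (tree_edges T) \<and>
     edge_src T ` tree_edges T \<subseteq> tree_verts T \<and> edge_tgt T ` tree_edges T \<subseteq> tree_verts T \<and>
     connected_graph T \<and> (\<nexists>hs. graph_cycle T hs) \<and>
     (\<forall>v\<in>tree_verts T. valency T v = 1 \<or> valency T v \<ge> 3)"

definition half_path :: "'a stokes_tree \<Rightarrow> nat \<times> bool \<Rightarrow> real \<Rightarrow> 'a" where
  "half_path T h t = (if snd h then edge_path T (fst h) t else edge_path T (fst h) (1 - t))"

text \<open>The type of the edge as a preStokes curve oriented away from the vertex of the half-edge:
  reversing the orientation of a preStokes curve swaps the two members of its type.\<close>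

definition half_sheet1 :: "'a stokes_tree \<Rightarrow> nat \<times> bool \<Rightarrow> real \<Rightarrow> 'a coeffs" where
  "half_sheet1 T h t =
     (if snd h then edge_sheet1 T (fst h) t else edge_sheet2 T (fst h) (1 - t))"

definition half_sheet2 :: "'a stokes_tree \<Rightarrow> nat \<times> bool \<Rightarrow> real \<Rightarrow> 'a coeffs" where
  "half_sheet2 T h t =
     (if snd h then edge_sheet2 T (fst h) t else edge_sheet1 T (fst h) (1 - t))"

text \<open>At its start the half-edge \<open>h\<close> has type \<open>(\<xi>, \<eta>)\<close>, the sheets being given by their points over
  the position of the vertex.\<close>

definition type_at_start ::
    "'a surface \<Rightarrow> 'a stokes_tree \<Rightarrow> nat \<times> bool \<Rightarrow> 'a coeffs \<Rightarrow> 'a coeffs \<Rightarrow> bool" where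
  "type_at_start S T h \<xi> \<eta> \<longleftrightarrow>
     limitin (cot_top S) (\<lambda>t. (half_path T h t, half_sheet1 T h t))
       (vert_pos T (half_start T h), \<xi>) (at_right 0) \<and>
     limitin (cot_top S) (\<lambda>t. (half_path T h t, half_sheet2 T h t))
       (vert_pos T (half_start T h), \<eta>) (at_right 0)"

text \<open>The half-edges \<open>h 0, \<dots>, h (k - 1)\<close> at \<open>v\<close> are listed counterclockwise: in a chart centred at
  the position of \<open>v\<close>, the small circle of radius \<open>\<rho>\<close> meets \<open>h i\<close>, at a time \<open>\<tau> i \<rho>\<close> tending to 0
  with \<open>\<rho>\<close>, in the point with argument \<open>\<alpha> i \<rho>\<close>, and these arguments increase within one turn. This
  makes sense also for half-edges that are tangent to each other, but it forces different half-edges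
  to be disjoint near \<open>v\<close>, as they should be for an immersed tree.\<close>

definition counterclockwise ::
    "'a surface \<Rightarrow> 'a stokes_tree \<Rightarrow> nat \<Rightarrow> nat \<Rightarrow> (nat \<Rightarrow> nat \<times> bool) \<Rightarrow> bool" where
  "counterclockwise S T v k h \<longleftrightarrow>
     (\<exists>c\<in>atlas S. vert_pos T v \<in> dom_of c \<and>
        (\<exists>(\<tau> :: nat \<Rightarrow> real \<Rightarrow> real) (\<alpha> :: nat \<Rightarrow> real \<Rightarrow> real).
           (\<forall>i<k. filterlim (\<tau> i) (at_right 0) (at_right 0)) \<and>
           (\<forall>\<^sub>F \<rho> in at_right 0.
              (\<forall>i<k. half_path T (h i) (\<tau> i \<rho>) \<in> dom_of c \<and>
                 coord c (half_path T (h i) (\<tau> i \<rho>)) =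
                   coord c (vert_pos T v) + of_real \<rho> * cis (\<alpha> i \<rho>)) \<and>
              (\<forall>i j. i < j \<and> j < k \<longrightarrow> \<alpha> i \<rho> < \<alpha> j \<rho>) \<and>
              \<alpha> (k - 1) \<rho> < \<alpha> 0 \<rho> + 2 * pi)))"

definition exterior_condition ::
    "'a surface \<Rightarrow> ('a \<times> 'a coeffs) set \<Rightarrow> 'a stokes_tree \<Rightarrow> nat \<Rightarrow> bool" where
  "exterior_condition S L T v \<longleftrightarrow>
     (\<forall>h\<in>half_edges_at T v. \<exists>\<xi>. (vert_pos T v, \<xi>) \<in> simple_branching_points S L \<and>
        type_at_start S T h \<xi> \<xi>)"

text \<open>The exchange of \<open>(s\<^bsub>i-1\<^esub>, s\<^sub>i)\<close> and \<open>(s\<^sub>i, s\<^bsub>i-1\<^esub>)\<close> is allowed for all edges at the vertex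
  simultaneously, the edges being oriented away from the vertex. This is the condition under which
  the lifts of the edges to the two sheets, with opposite orientations, close up to a cycle in \<open>L\<close>
  at the vertex; exchanges made independently for the individual edges would destroy it. Near an
  interior vertex \<open>L\<close> is unramified, so sheets are given by points of the fibre.\<close>

definition interior_condition ::
    "'a surface \<Rightarrow> 'a set \<Rightarrow> ('a \<times> 'a coeffs) set \<Rightarrow> 'a stokes_tree \<Rightarrow> nat \<Rightarrow> bool" where
  "interior_condition S D L T v \<longleftrightarrow>
     vert_pos T v \<in> points S - (D \<union> branching_values S L) \<and>
     (\<exists>h (s :: nat \<Rightarrow> 'a coeffs). let k = valency T v in
        bij_betw h {..<k} (half_edges_at T v) \<and> counterclockwise S T v k h \<and>
        (\<forall>i<k. (vert_pos T v, s i) \<in> L) \<and>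
        ((\<forall>i<k. type_at_start S T (h i) (s ((i + k - 1) mod k)) (s i)) \<or>
         (\<forall>i<k. type_at_start S T (h i) (s i) (s ((i + k - 1) mod k)))))"

text \<open>Parametrized trees: representatives of closed Stokes trees, which are to be taken up to
  reparametrization.\<close>

definition closed_Stokes_trees ::
    "'a surface \<Rightarrow> 'a set \<Rightarrow> ('a \<times> 'a coeffs) set \<Rightarrow> real \<Rightarrow> 'a stokes_tree set" where
  "closed_Stokes_trees S D L \<theta> = {T. finite_tree T \<and>
     (\<forall>e\<in>tree_edges T.
        continuous_map (top_of_set {0..1}) (surf_top S) (edge_path T e) \<and>
        edge_path T e 0 = vert_pos T (edge_src T e) \<and>
        edge_path T e 1 = vert_pos T (edge_tgt T e) \<and>
        preStokes_curve S D L \<theta> (edge_path T e) (edge_sheet1 T e) (edge_sheet2 T e)) \<and>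
     (\<forall>v\<in>tree_verts T. valency T v = 1 \<longrightarrow> exterior_condition S L T v) \<and>
     (\<forall>v\<in>tree_verts T. valency T v \<ge> 3 \<longrightarrow> interior_condition S D L T v)}"

text \<open>The circle \<open>\<real>/\<int>\<close> is identified with the unit circle by \<open>\<theta> \<mapsto> e\<^bsup>2\<pi>i\<theta>\<^esup>\<close>.\<close>

definition unobstructed_angles ::
    "'a surface \<Rightarrow> 'a set \<Rightarrow> ('a \<times> 'a coeffs) set \<Rightarrow> complex set" where
  "unobstructed_angles S D L =
     {exp (2 * of_real pi * \<i> * of_real \<theta>) | \<theta>. closed_Stokes_trees S D L \<theta> = {}}"

end

theory Submission
  imports Defs
begin

text \<open>
  Only countably many angles are obstructed. The lifts of the edges of a closed Stokes tree to their
  two sheets, with opposite orientations, form a closed chain in \<open>L\<close>, because the sheets agree at the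
  exterior vertices and are arranged cyclically at the interior ones. Hence the integral of the Liouville
  form over it lies in the group of periods, which is countable since \<open>L\<close> is second countable. On
  the other hand each edge contributes a positive multiple of \<open>e\<^bsup>2\<pi>i\<theta>\<^esup>\<close> to this integral. So
  \<open>e\<^bsup>2\<pi>i\<theta>\<^esup>\<close> is the phase of a nonzero period. The complement of a countable set of angles is dense.
\<close>

section \<open>Lifts of differentiable maps and changes of charts\<close>

text \<open>No path integral is formed. An edge is smooth only on the open unit interval and its
  lifts merely converge at the ends, possibly to branching points, so integrating up to the ends
  would call for extra estimates. Increments of a single function \<open>F\<close> on
  \<open>L\<close>, read modulo a countable group \<open>G\<close>, take the place of integrals:
  near each point \<open>F\<close> agrees with a local primitive up to values in \<open>G\<close>.
  Primitives are continuous on \<open>L\<close> also at branching points, so the ends cost nothing,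
  and derivatives are taken only at interior times, where the base coordinate is a coordinate on
  \<open>L\<close>.

  Accordingly \<open>G\<close> is not built from homology. It is generated by the differences of
  countably many local primitives, and it may exceed the group of periods because the constants of
  integration are arbitrary. Nothing makes \<open>G\<close> discrete, so the argument bounds the
  obstructed angles by a countable set, not by a finite one.\<close>

lemma holomorphic_local_inverse:
  assumes "f holomorphic_on A" "open A" "a \<in> A" "deriv f a \<noteq> 0"
  obtains g where "(g has_field_derivative inverse (deriv f a)) (at (f a))"
    "\<forall>\<^sub>F y in nhds a. g (f y) = y"
proof -
  obtain r where r: "r > 0" "ball a r \<subseteq> A" "open (f ` ball a r)" "inj_on f (ball a r)"
    using has_complex_derivative_locally_invertible[OF assms(1,3,2,4)] by blast
  obtain g where g: "g holomorphic_on (f ` ball a r)"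
      "\<And>z. z \<in> ball a r \<Longrightarrow> deriv f z * deriv g (f z) = 1"
      "\<And>z. z \<in> ball a r \<Longrightarrow> g (f z) = z"
    using holomorphic_has_inverse[OF holomorphic_on_subset[OF assms(1) r(2)] open_ball r(4)] by blast
  have "(g has_field_derivative deriv g (f a)) (at (f a))"
    using g(1) r by (intro holomorphic_derivI[OF _ r(3)]) auto
  moreover have "deriv g (f a) = inverse (deriv f a)"
    using g(2)[of a] r(1) by (simp add: inverse_unique)
  moreover have "\<forall>\<^sub>F y in nhds a. g (f y) = y"
    using eventually_nhds_in_open[of "ball a r" a] r(1) by (auto elim!: eventually_mono intro: g(3))
  ultimately show thesis using that by simp
qed

text \<open>Near \<open>x\<close> the map \<phi> is the composition of a local inverse of
  \<open>f\<close> with f o \<phi>, so only continuity of \<phi> must be known beforehand. This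
  serves for coordinate changes on \<open>L\<close>, which at first are only known to be
  continuous.\<close>

lemma field_derivative_lift:
  assumes "f holomorphic_on A" "open A" "\<phi> x \<in> A" "deriv f (\<phi> x) \<noteq> 0" "isCont \<phi> x"
    and "((\<lambda>y. f (\<phi> y)) has_field_derivative E) (at x)"
  shows "(\<phi> has_field_derivative E / deriv f (\<phi> x)) (at x)"
proof -
  obtain g where g: "(g has_field_derivative inverse (deriv f (\<phi> x))) (at (f (\<phi> x)))"
    "\<forall>\<^sub>F y in nhds (\<phi> x). g (f y) = y"
    using holomorphic_local_inverse[OF assms(1-4)] .
  have ev: "\<forall>\<^sub>F y in nhds x. g (f (\<phi> y)) = \<phi> y"
    using eventually_compose_filterlim[OF g(2), of \<phi> "nhds x"] assms(5)
    by (simp add: isCont_def tendsto_at_iff_tendsto_nhds)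
  have "((\<lambda>y. g (f (\<phi> y))) has_field_derivative inverse (deriv f (\<phi> x)) * E) (at x)"
    by (rule DERIV_chain2[OF g(1) assms(6)])
  moreover have "((\<lambda>y. g (f (\<phi> y))) has_field_derivative inverse (deriv f (\<phi> x)) * E) (at x)
    \<longleftrightarrow> (\<phi> has_field_derivative inverse (deriv f (\<phi> x)) * E) (at x)"
    using ev by (intro DERIV_cong_ev) auto
  ultimately show ?thesis by (simp add: field_simps)
qed

text \<open>The same argument for a real parameter; it differentiates the lift to \<open>L\<close>
  of a curve in the base.\<close>

lemma vector_derivative_lift:
  fixes \<phi> :: "real \<Rightarrow> complex"
  assumes "f holomorphic_on A" "open A" "\<phi> x \<in> A" "deriv f (\<phi> x) \<noteq> 0" "isCont \<phi> x"
    and "((\<lambda>y. f (\<phi> y)) has_vector_derivative E) (at x)"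
  shows "(\<phi> has_vector_derivative E / deriv f (\<phi> x)) (at x)"
proof -
  obtain g where g: "(g has_field_derivative inverse (deriv f (\<phi> x))) (at (f (\<phi> x)))"
    "\<forall>\<^sub>F y in nhds (\<phi> x). g (f y) = y"
    using holomorphic_local_inverse[OF assms(1-4)] .
  have ev: "\<forall>\<^sub>F y in nhds x. g (f (\<phi> y)) = \<phi> y"
    using eventually_compose_filterlim[OF g(2), of \<phi> "nhds x"] assms(5)
    by (simp add: isCont_def tendsto_at_iff_tendsto_nhds)
  have "((g \<circ> (\<lambda>y. f (\<phi> y))) has_vector_derivative E * inverse (deriv f (\<phi> x))) (at x)"
    by (rule field_vector_diff_chain_at[OF assms(6)]) (use g(1) in auto)
  then have "(\<phi> has_vector_derivative E * inverse (deriv f (\<phi> x))) (at x)"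
    using eventually_nhds_x_imp_x[OF ev] ev 
    by (subst (asm) has_vector_derivative_cong_ev[where g=\<phi>]) (auto elim!: eventually_mono)
  then show ?thesis by (simp add: field_simps)
qed

lemma chart_facts:
  assumes "complex_curve S" "c \<in> atlas S"
  shows chart_inj: "inj_on (coord c) (dom_of c)"
    and open_dom: "openin (surf_top S) (dom_of c)"
    and open_coord_image: "openin (surf_top S) U \<Longrightarrow> open (coord c ` (dom_of c \<inter> U))"
proof -
  have h: "homeomorphic_map (subtopology (surf_top S) (dom_of c))
          (top_of_set (coord c ` dom_of c)) (coord c)" and o: "openin (surf_top S) (dom_of c)"
    and oc: "open (coord c ` dom_of c)"
    using assms unfolding complex_curve_def by auto
  then show "inj_on (coord c) (dom_of c)"
    by (metis homeomorphic_imp_injective_map inf.absorb_iff2 openin_subset topspace_subtopology)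
  show "openin (surf_top S) (dom_of c)" by (rule o)
  assume "openin (surf_top S) U"
  then have "openin (subtopology (surf_top S) (dom_of c)) (dom_of c \<inter> U)"
    by (simp add: openin_subtopology_Int2)
  then have "openin (top_of_set (coord c ` dom_of c)) (coord c ` (dom_of c \<inter> U))"
    using homeomorphic_imp_open_map[OF h] by (simp add: open_map_def)
  then show "open (coord c ` (dom_of c \<inter> U))"
    using oc openin_open_trans by blast
qed

lemma chart_inv_coord:
  assumes "complex_curve S" "c \<in> atlas S" "x \<in> dom_of c"
  shows "chart_inv c (coord c x) = x"
  using chart_inj[OF assms(1,2)] assms(3) by (simp add: chart_inv_def)

lemma transition_holomorphic:
  assumes "complex_curve S" "c \<in> atlas S" "c' \<in> atlas S"
  shows "(coord c' \<circ> chart_inv c) holomorphic_on coord c ` (dom_of c \<inter> dom_of c')"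
    and "open (coord c ` (dom_of c \<inter> dom_of c'))"
proof -
  show "(coord c' \<circ> chart_inv c) holomorphic_on coord c ` (dom_of c \<inter> dom_of c')"
    using assms unfolding complex_curve_def by blast
  show "open (coord c ` (dom_of c \<inter> dom_of c'))"
    by (rule open_coord_image[OF assms(1,2) open_dom[OF assms(1,3)]])
qed

lemma canonical_fibre_transition:
  assumes "\<xi> \<in> canonical_fibre S 1 x" "c \<in> atlas S" "c' \<in> atlas S" "x \<in> dom_of c" "x \<in> dom_of c'"
  shows "\<xi> c = \<xi> c' * deriv (coord c' \<circ> chart_inv c) (coord c x)"
proof -
  have "\<forall>c\<in>atlas S. \<forall>c'\<in>atlas S. x \<in> dom_of c \<inter> dom_of c' \<longrightarrow>
      \<xi> c = \<xi> c' * deriv (coord c' \<circ> chart_inv c) (coord c x) ^ 1"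
    using assms(1) unfolding canonical_fibre_def mem_Collect_eq by (rule conjunct1)
  from bspec[OF bspec[OF this assms(2)] assms(3)] assms(4,5) show ?thesis
    by (simp only: power_one_right Int_iff simp_thms)
qed

text \<open>The derivative of the transition map enters twice, in the transformation of the covector
  and, by the chain rule, in that of the velocity, and the two factors match.\<close>

lemma difference_form_chart_independent:
  assumes S: "complex_curve S" and c: "c \<in> atlas S" "c' \<in> atlas S" "\<gamma> t \<in> dom_of c" "\<gamma> t \<in> dom_of c'"
    and \<xi>: "\<xi> \<in> canonical_fibre S 1 (\<gamma> t)"
    and t: "t \<in> A" "open A" and \<gamma>: "continuous_map (top_of_set A) (surf_top S) \<gamma>"
    and D: "((coord c \<circ> \<gamma>) has_vector_derivative v) (at t)"
  shows "\<xi> c * vector_derivative (coord c \<circ> \<gamma>) (at t) = \<xi> c' * vector_derivative (coord c' \<circ> \<gamma>) (at t)"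
proof -
  let ?T = "coord c' \<circ> chart_inv c"
  have "openin (top_of_set A) {s \<in> A. \<gamma> s \<in> dom_of c}"
    using openin_continuous_map_preimage[OF \<gamma> open_dom[OF S c(1)]] by simp
  then have "open {s \<in> A. \<gamma> s \<in> dom_of c}"
    using t(2) openin_open_trans by blast
  then have "\<forall>\<^sub>F s in nhds t. s \<in> {s \<in> A. \<gamma> s \<in> dom_of c}"
    using t c(3) by (intro eventually_nhds_in_open) auto
  then have ev: "\<forall>\<^sub>F s in nhds t. (?T \<circ> (coord c \<circ> \<gamma>)) s = (coord c' \<circ> \<gamma>) s"
    by eventually_elim (simp add: chart_inv_coord[OF S c(1)])
  have "(?T has_field_derivative deriv ?T (coord c (\<gamma> t))) (at (coord c (\<gamma> t)))"
    using c by (intro holomorphic_derivI[OF transition_holomorphic[OF S c(1,2)]]) auto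
  then have "((?T \<circ> (coord c \<circ> \<gamma>)) has_vector_derivative v * deriv ?T (coord c (\<gamma> t))) (at t)"
    by (intro field_vector_diff_chain_at[OF D]) auto
  then have "((coord c' \<circ> \<gamma>) has_vector_derivative v * deriv ?T (coord c (\<gamma> t))) (at t)"
    using ev eventually_nhds_x_imp_x[OF ev] 
    by (subst (asm) has_vector_derivative_cong_ev[where g="coord c' \<circ> \<gamma>"]) (auto elim!: eventually_mono)
  then show ?thesis
    using D canonical_fibre_transition[OF \<xi> c] by (simp add: vector_derivative_at)
qed

section \<open>Local primitives of the Liouville form\<close>

locale Lagrangian_curve =
  fixes S :: "'a surface" and L :: "('a \<times> 'a coeffs) set"
  assumes curve: "complex_curve S" and Lagrangian: "Lagrangian_submanifold S L"
begin

abbreviation "open_in_L \<equiv> openin (subtopology (cot_top S) L)"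

lemma in_fibre: "(x, \<xi>) \<in> L \<Longrightarrow> \<xi> \<in> canonical_fibre S 1 x"
  using subsetD[OF conjunct1[OF Lagrangian[unfolded Lagrangian_submanifold_def]], of "(x, \<xi>)"]
  by (simp add: cotangent_def)

lemma centred_parametrization:
  assumes "p \<in> L"
  obtains c r g where "local_parametrization S L c r g" "g 0 = p"
  using bspec[OF conjunct2[OF Lagrangian[unfolded Lagrangian_submanifold_def]] assms] that by blast

lemma parametrizationD:
  assumes "local_parametrization S L c r g"
  shows "c \<in> atlas S" "0 < r" "\<And>w. w \<in> ball 0 r \<Longrightarrow> fst (g w) \<in> dom_of c"
    and "open_in_L (g ` ball 0 r)" "g ` ball 0 r \<subseteq> L" "inj_on g (ball 0 r)"
    and "continuous_map (top_of_set (ball 0 r)) (cot_top S) g"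
    and "continuous_map (subtopology (cot_top S) (g ` ball 0 r)) (top_of_set (ball 0 r)) (inv_into (ball 0 r) g)"
    and "(\<lambda>w. coord c (fst (g w))) holomorphic_on ball 0 r"
    and "(\<lambda>w. snd (g w) c) holomorphic_on ball 0 r"
    and "\<And>w. w \<in> ball 0 r \<Longrightarrow>
      deriv (\<lambda>w. coord c (fst (g w))) w \<noteq> 0 \<or> deriv (\<lambda>w. snd (g w) c) w \<noteq> 0"
    and "\<And>A. openin (top_of_set (ball 0 r)) A \<Longrightarrow> open_in_L (g ` A)"
proof -
  have fs: "(\<lambda>w. fst (cot_coord c (g w))) = (\<lambda>w. coord c (fst (g w)))"
    "(\<lambda>w. snd (cot_coord c (g w))) = (\<lambda>w. snd (g w) c)"
    by (auto simp: cot_coord_def case_prod_beta)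
  note * = assms[unfolded local_parametrization_def fs]
  show "c \<in> atlas S" "0 < r" "\<And>w. w \<in> ball 0 r \<Longrightarrow> fst (g w) \<in> dom_of c"
    and op: "open_in_L (g ` ball 0 r)"
    and "(\<lambda>w. coord c (fst (g w))) holomorphic_on ball 0 r"
    and "(\<lambda>w. snd (g w) c) holomorphic_on ball 0 r"
    and "\<And>w. w \<in> ball 0 r \<Longrightarrow>
      deriv (\<lambda>w. coord c (fst (g w))) w \<noteq> 0 \<or> deriv (\<lambda>w. snd (g w) c) w \<noteq> 0"
    using * by auto
  have h: "homeomorphic_map (top_of_set (ball 0 r)) (subtopology (cot_top S) (g ` ball 0 r)) g"
    using * by auto
  show inj: "inj_on g (ball 0 r)"
    using homeomorphic_imp_injective_map[OF h] by simp
  show sub: "g ` ball 0 r \<subseteq> L"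
    using openin_subset[OF op] by auto
  show "continuous_map (top_of_set (ball 0 r)) (cot_top S) g"
    using homeomorphic_imp_continuous_map[OF h] continuous_map_in_subtopology by blast
  obtain k where k: "homeomorphic_maps (top_of_set (ball 0 r)) (subtopology (cot_top S) (g ` ball 0 r)) g k"
    using h homeomorphic_map_maps by blast
  then have "continuous_map (subtopology (cot_top S) (g ` ball 0 r)) (top_of_set (ball 0 r)) k"
    by (simp add: homeomorphic_maps_def)
  moreover have "k y = inv_into (ball 0 r) g y" if "y \<in> g ` ball 0 r" for y
    using that k inj by (auto simp: homeomorphic_maps_def)
  ultimately show "continuous_map (subtopology (cot_top S) (g ` ball 0 r)) (top_of_set (ball 0 r)) (inv_into (ball 0 r) g)"
    by (auto intro: continuous_map_eq)
  fix A :: "complex set" assume "openin (top_of_set (ball 0 r)) A"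
  then have "openin (subtopology (cot_top S) (g ` ball 0 r)) (g ` A)"
    using homeomorphic_imp_open_map[OF h] by (simp add: open_map_def)
  then have "openin (subtopology (subtopology (cot_top S) L) (g ` ball 0 r)) (g ` A)"
    using sub by (simp add: subtopology_subtopology inf.absorb2)
  then show "open_in_L (g ` A)"
    using op openin_trans_full by blast
qed

lemma continuous_eventually_in:
  assumes f: "continuous_map (top_of_set A) (cot_top S) f" and "open A" "f ` A \<subseteq> L" "t \<in> A"
    and U: "open_in_L U" "f t \<in> U"
  shows "\<forall>\<^sub>F x in nhds t. x \<in> A \<and> f x \<in> U"
proof -
  have "continuous_map (top_of_set A) (subtopology (cot_top S) L) f"
    using f assms(3) by (simp add: continuous_map_in_subtopology image_subset_iff_funcset)
  then have "openin (top_of_set A) {x \<in> A. f x \<in> U}"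
    using openin_continuous_map_preimage[OF _ U(1)] by fastforce
  then have "open {x \<in> A. f x \<in> U}"
    using assms(2) openin_open_trans by blast
  then have "\<forall>\<^sub>F x in nhds t. x \<in> {x \<in> A. f x \<in> U}"
    using assms by (intro eventually_nhds_in_open) auto
  then show ?thesis by eventually_elim auto
qed

lemma isCont_on_L:
  fixes h :: "_ \<Rightarrow> complex"
  assumes f: "continuous_map (top_of_set A) (cot_top S) f" and "open A" "f ` A \<subseteq> L" "t \<in> A"
    and U: "open_in_L U" "f t \<in> U" and h: "continuous_map (subtopology (cot_top S) U) euclidean h"
  shows "isCont (\<lambda>x. h (f x)) t"
proof -
  obtain B where B: "open B" "t \<in> B" "\<And>x. x \<in> B \<Longrightarrow> x \<in> A \<and> f x \<in> U"
    using continuous_eventually_in[OF assms(1-6)] by (auto simp: eventually_nhds)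
  have "continuous_map (top_of_set B) (subtopology (cot_top S) U) f"
    using B continuous_map_from_subtopology_mono[OF f, of B]
    by (auto simp: continuous_map_in_subtopology)
  from continuous_map_compose[OF this h] have "continuous_on B (h \<circ> f)" by simp
  then show ?thesis using B continuous_on_eq_continuous_at by (fastforce simp: o_def)
qed

text \<open>At a branching point the base coordinate has derivative zero along \<open>L\<close>, so
  differentiability of the coordinate change \<phi> cannot be read off from it; regularity of the
  parametrization makes the fibre coordinate usable there. Once \<phi> is differentiable, the
  equation is the chain rule combined with the transformation law of covectors.\<close>

lemma parametrization_transition:
  assumes P: "local_parametrization S L c r g" and Q: "local_parametrization S L d s f"
    and w: "w \<in> ball 0 s" "f w \<in> g ` ball 0 r"
  defines "\<phi> \<equiv> \<lambda>w. inv_into (ball 0 r) g (f w)"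
  obtains e where "(\<phi> has_field_derivative e) (at w)"
    "snd (f w) d * deriv (\<lambda>w. coord d (fst (f w))) w =
     snd (f w) c * deriv (\<lambda>w. coord c (fst (g w))) (\<phi> w) * e"
proof -
  note p = parametrizationD[OF P] and q = parametrizationD[OF Q]
  let ?z = "\<lambda>w. coord c (fst (g w))" and ?y = "\<lambda>w. coord d (fst (f w))"
  let ?T = "coord c \<circ> chart_inv d" and ?R = "coord d \<circ> chart_inv c"
  have g\<phi>: "g (\<phi> v) = f v" "\<phi> v \<in> ball 0 r" if "f v \<in> g ` ball 0 r" for v
    using that unfolding \<phi>_def by (simp_all only: f_inv_into_f inv_into_into)
  have dom: "fst (f v) \<in> dom_of d" "fst (f v) \<in> dom_of c" if "v \<in> ball 0 s" "f v \<in> g ` ball 0 r" for v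
    using that p(3) q(3) by force+
  have ev: "\<forall>\<^sub>F v in nhds w. v \<in> ball 0 s \<and> f v \<in> g ` ball 0 r"
    using continuous_eventually_in[OF q(7) _ q(5) w(1) p(4) w(2)] by simp
  have cont: "isCont \<phi> w"
    unfolding \<phi>_def
    using isCont_on_L[OF q(7) _ q(5) w(1) p(4) w(2)] p(8) by (simp add: continuous_map_in_subtopology)
  have fib: "snd (f v) \<in> canonical_fibre S 1 (fst (f v))" if "v \<in> ball 0 s" for v
    using q(5) that in_fibre[of "fst (f v)" "snd (f v)"] by force
  have Dy: "(?y has_field_derivative deriv ?y w) (at w)"
    using w by (intro holomorphic_derivI[OF q(9)]) auto
  have yT: "?y w \<in> coord d ` (dom_of d \<inter> dom_of c)" "?T (?y w) \<in> coord c ` (dom_of c \<inter> dom_of d)"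
    using dom[OF w] chart_inv_coord[OF curve q(1)] by auto
  have "(?T has_field_derivative deriv ?T (?y w)) (at (?y w))"
    by (rule holomorphic_derivI[OF transition_holomorphic[OF curve q(1) p(1)] yT(1)])
  then have DTy: "((\<lambda>v. ?T (?y v)) has_field_derivative deriv ?T (?y w) * deriv ?y w) (at w)"
    by (rule DERIV_chain2[OF _ Dy])
  have z\<phi>: "?T (?y v) = ?z (\<phi> v)" if "v \<in> ball 0 s" "f v \<in> g ` ball 0 r" for v
    using dom[OF that] g\<phi>[OF that(2)] chart_inv_coord[OF curve q(1)] by auto
  then have "\<forall>\<^sub>F v in nhds w. ?T (?y v) = ?z (\<phi> v)"
    using ev by (auto elim!: eventually_mono)
  then have Dz: "((\<lambda>v. ?z (\<phi> v)) has_field_derivative deriv ?T (?y w) * deriv ?y w) (at w)"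
    using DTy by (subst (asm) DERIV_cong_ev[OF refl _ refl])
  \<comment> \<open>The fibre coordinate in chart \<open>c\<close> is the one in chart
    \<open>d\<close> times \<open>deriv ?R\<close>, so its derivative involves the second derivative
    of the transition map.\<close>
  have "(deriv ?R has_field_derivative deriv (deriv ?R) (?T (?y w))) (at (?T (?y w)))"
    by (rule holomorphic_derivI[OF holomorphic_deriv[OF transition_holomorphic[OF curve p(1) q(1)]]
         transition_holomorphic(2)[OF curve p(1) q(1)] yT(2)])
  then have "((\<lambda>v. deriv ?R (?T (?y v))) has_field_derivative
      deriv (deriv ?R) (?T (?y w)) * (deriv ?T (?y w) * deriv ?y w)) (at w)"
    by (rule DERIV_chain2[OF _ DTy])
  moreover have "((\<lambda>w. snd (f w) d) has_field_derivative deriv (\<lambda>w. snd (f w) d) w) (at w)"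
    using w by (intro holomorphic_derivI[OF q(10)]) auto
  ultimately obtain E where "((\<lambda>v. snd (f v) d * deriv ?R (?T (?y v))) has_field_derivative E) (at w)"
    using DERIV_mult by blast
  moreover have "snd (f v) d * deriv ?R (?T (?y v)) = snd (g (\<phi> v)) c"
    if "v \<in> ball 0 s" "f v \<in> g ` ball 0 r" for v
    using canonical_fibre_transition[OF fib p(1) q(1)] dom[OF that] that g\<phi>[OF that(2)] z\<phi>[OF that]
    by simp
  then have "\<forall>\<^sub>F v in nhds w. snd (f v) d * deriv ?R (?T (?y v)) = snd (g (\<phi> v)) c"
    using ev by (auto elim!: eventually_mono)
  ultimately have D\<zeta>: "((\<lambda>v. snd (g (\<phi> v)) c) has_field_derivative E) (at w)"
    by (subst (asm) DERIV_cong_ev[OF refl _ refl])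
  \<comment> \<open>Lift through whichever of the two coordinates has nonzero derivative at
    \<open>\<phi> w\<close>.\<close>
  obtain e where e: "(\<phi> has_field_derivative e) (at w)"
    using p(11)[OF g\<phi>(2)[OF w(2)]]
      field_derivative_lift[OF p(9) open_ball g\<phi>(2)[OF w(2)] _ cont Dz]
      field_derivative_lift[OF p(10) open_ball g\<phi>(2)[OF w(2)] _ cont D\<zeta>] by blast
  have "(?z has_field_derivative deriv ?z (\<phi> w)) (at (\<phi> w))"
    using g\<phi>(2)[OF w(2)] by (intro holomorphic_derivI[OF p(9)]) auto
  then have "((\<lambda>v. ?z (\<phi> v)) has_field_derivative deriv ?z (\<phi> w) * e) (at w)"
    by (rule DERIV_chain2[OF _ e])
  with Dz have "deriv ?T (?y w) * deriv ?y w = deriv ?z (\<phi> w) * e"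
    by (rule DERIV_unique)
  moreover have "snd (f w) d = snd (f w) c * deriv ?T (?y w)"
    using canonical_fibre_transition[OF fib[OF w(1)] q(1) p(1)] dom[OF w] by simp
  ultimately show thesis
    by (intro that[OF e]) (simp add: mult.assoc)
qed

text \<open>\<open>F\<close> is a primitive on \<open>U\<close> of the restriction of the Liouville form to \<open>L\<close>.\<close>

definition primitive :: "('a \<times> 'a coeffs) set \<Rightarrow> ('a \<times> 'a coeffs \<Rightarrow> complex) \<Rightarrow> bool" where
  "primitive U F \<longleftrightarrow> open_in_L U \<and> continuous_map (subtopology (cot_top S) U) euclidean F \<and>
     (\<forall>c r g w. local_parametrization S L c r g \<and> w \<in> ball 0 r \<and> g w \<in> U \<longrightarrow>
        ((\<lambda>w. F (g w)) has_field_derivative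
           snd (g w) c * deriv (\<lambda>w. coord c (fst (g w))) w) (at w))"

lemma primitiveD:
  assumes "primitive U F"
  shows "open_in_L U" "continuous_map (subtopology (cot_top S) U) euclidean F"
    and "local_parametrization S L c r g \<Longrightarrow> w \<in> ball 0 r \<Longrightarrow> g w \<in> U \<Longrightarrow>
      ((\<lambda>w. F (g w)) has_field_derivative snd (g w) c * deriv (\<lambda>w. coord c (fst (g w))) w) (at w)"
proof -
  show "open_in_L U" "continuous_map (subtopology (cot_top S) U) euclidean F"
    by (rule conjunct1[OF assms[unfolded primitive_def]]
          conjunct1[OF conjunct2[OF assms[unfolded primitive_def]]])+
  show "((\<lambda>w. F (g w)) has_field_derivative snd (g w) c * deriv (\<lambda>w. coord c (fst (g w))) w) (at w)"
    if "local_parametrization S L c r g" "w \<in> ball 0 r" "g w \<in> U"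
    using conjunct2[OF conjunct2[OF assms[unfolded primitive_def]]] that by blast
qed

text \<open>A disk is convex, so the pulled back form has a primitive there;
  \<open>parametrization_transition\<close> carries the derivative formula over to all other
  parametrizations, as \<open>primitive\<close> demands.\<close>

lemma primitive_exists:
  assumes "p \<in> L"
  obtains U F where "primitive U F" "p \<in> U"
proof -
  obtain c r g where P: "local_parametrization S L c r g" and p0: "g 0 = p"
    using centred_parametrization[OF assms] .
  note p = parametrizationD[OF P]
  let ?\<phi> = "inv_into (ball 0 r) g"
  let ?h = "\<lambda>w. snd (g w) c * deriv (\<lambda>w. coord c (fst (g w))) w"
  have "?h holomorphic_on ball 0 r"
    by (intro holomorphic_intros p holomorphic_deriv) auto
  then obtain G where "\<And>x. x \<in> ball 0 r \<Longrightarrow> (G has_field_derivative ?h x) (at x within ball 0 r)"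
    using holomorphic_convex_primitive'[OF convex_ball open_ball] by blast
  then have G: "\<And>x. x \<in> ball 0 r \<Longrightarrow> (G has_field_derivative ?h x) (at x)"
    by (metis at_within_open open_ball)
  then have "continuous_on (ball 0 r) G"
    by (intro continuous_at_imp_continuous_on ballI DERIV_isCont[OF G])
  then have cont: "continuous_map (subtopology (cot_top S) (g ` ball 0 r)) euclidean (G \<circ> ?\<phi>)"
    by (intro continuous_map_compose[OF p(8)]) auto
  have "primitive (g ` ball 0 r) (G \<circ> ?\<phi>)"
    unfolding primitive_def
  proof (intro conjI allI impI)
    fix d s f w
    assume A: "local_parametrization S L d s f \<and> w \<in> ball 0 s \<and> f w \<in> g ` ball 0 r"
    then obtain e where e: "((\<lambda>w. ?\<phi> (f w)) has_field_derivative e) (at w)"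
      "snd (f w) d * deriv (\<lambda>w. coord d (fst (f w))) w =
        snd (f w) c * deriv (\<lambda>w. coord c (fst (g w))) (?\<phi> (f w)) * e"
      using parametrization_transition[OF P] by blast
    have "((\<lambda>w. G (?\<phi> (f w))) has_field_derivative ?h (?\<phi> (f w)) * e) (at w)"
      using A by (intro DERIV_chain2[OF G e(1)] inv_into_into) blast
    then show "((\<lambda>w. (G \<circ> ?\<phi>) (f w)) has_field_derivative
       snd (f w) d * deriv (\<lambda>w. coord d (fst (f w))) w) (at w)"
      using A by (simp add: e(2) f_inv_into_f)
  qed (use p cont in auto)
  moreover have "p \<in> g ` ball 0 r" using p0 p(2) by force
  ultimately show thesis by (rule that)
qed

text \<open>In a parametrizing disk about \<open>p\<close> both derivatives are the same expression,
  and a smaller disk mapped into the overlap is connected. Only local constancy can be expected,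
  since the overlap may be disconnected.\<close>

lemma primitive_difference_locally_constant:
  assumes U: "primitive U F" and V: "primitive V G" and p: "p \<in> U" "p \<in> V"
  obtains W where "open_in_L W" "p \<in> W" "\<And>q. q \<in> W \<Longrightarrow> q \<in> U \<and> q \<in> V \<and> F q - G q = F p - G p"
proof -
  have o: "open_in_L (U \<inter> V)" using U V by (auto simp: primitive_def)
  then have "p \<in> L" using openin_subset p by fastforce
  then obtain c r g where P: "local_parametrization S L c r g" and p0: "g 0 = p"
    using centred_parametrization by blast
  note P' = parametrizationD[OF P]
  have "\<forall>\<^sub>F w in nhds 0. w \<in> ball 0 r \<and> g w \<in> U \<inter> V"
    using p p0 P'(2) by (intro continuous_eventually_in[OF P'(7) _ P'(5) _ o]) auto
  then obtain d where d: "d > 0" "\<And>w. w \<in> ball 0 d \<Longrightarrow> w \<in> ball 0 r \<and> g w \<in> U \<inter> V"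
    unfolding eventually_nhds_metric by (auto simp: dist_commute)
  have "((\<lambda>w. F (g w) - G (g w)) has_field_derivative 0) (at w within ball 0 d)" if "w \<in> ball 0 d" for w
  proof -
    have "((\<lambda>w. F (g w) - G (g w)) has_field_derivative
      snd (g w) c * deriv (\<lambda>w. coord c (fst (g w))) w - snd (g w) c * deriv (\<lambda>w. coord c (fst (g w))) w) (at w)"
      using d(2)[OF that]
      by (intro DERIV_diff primitiveD(3)[OF U P] primitiveD(3)[OF V P]) blast+
    then show ?thesis by (simp add: has_field_derivative_at_within)
  qed
  then obtain k where k: "\<And>w. w \<in> ball 0 d \<Longrightarrow> F (g w) - G (g w) = k"
    using has_field_derivative_zero_constant[OF convex_ball, of 0 d "\<lambda>w. F (g w) - G (g w)"] by auto
  have const: "F (g w) - G (g w) = F p - G p" if "w \<in> ball 0 d" for w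
    using k[OF that] k[of 0] d(1) p0 by simp
  have "open_in_L (g ` ball 0 d)"
    using d(2) by (intro P'(12)) (simp add: open_subset subset_iff)
  then show thesis
  proof (rule that)
    show "p \<in> g ` ball 0 d" using p0 d(1) by force
    fix q assume "q \<in> g ` ball 0 d"
    then obtain w where w: "w \<in> ball 0 d" "q = g w" by blast
    show "q \<in> U \<and> q \<in> V \<and> F q - G q = F p - G p"
      using d(2)[OF w(1)] const[OF w(1)] unfolding w(2) by blast
  qed
qed

end

section \<open>Branching of the projection and differentiation along curves\<close>

locale spectral_Lagrangian = Lagrangian_curve +
  assumes finite_fibres: "\<And>c x. c \<in> atlas S \<Longrightarrow> x \<in> dom_of c \<Longrightarrow> finite {\<xi> c | \<xi>. (x, \<xi>) \<in> L}"
begin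

text \<open>Otherwise a whole disk of \<open>L\<close> would lie in one cotangent fibre, and the
  fibre coordinate would embed this uncountable disk into the finite set of
  \<open>finite_fibres\<close>.\<close>

lemma projection_not_constant:
  assumes P: "local_parametrization S L c r g"
  shows "\<exists>w\<in>ball 0 r. coord c (fst (g w)) \<noteq> coord c (fst (g 0))"
proof (rule ccontr)
  note p = parametrizationD[OF P]
  assume "\<not> ?thesis"
  then have const: "coord c (fst (g w)) = coord c (fst (g 0))" if "w \<in> ball 0 r" for w
    using that by blast
  have 0: "(0::complex) \<in> ball 0 r" using p(2) by simp
  have fst: "fst (g w) = fst (g 0)" if "w \<in> ball 0 r" for w
    using inj_onD[OF chart_inj[OF curve p(1)] const[OF that] p(3)[OF that] p(3)[OF 0]] .
  have "(\<lambda>w. snd (g w) c) ` ball 0 r \<subseteq> {\<xi> c | \<xi>. (fst (g 0), \<xi>) \<in> L}"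
  proof safe
    fix w :: complex assume w: "w \<in> ball 0 r"
    then have "g w \<in> L" using p(5) by blast
    then have "(fst (g 0), snd (g w)) \<in> L" using fst[OF w] by (metis prod.collapse)
    then show "\<exists>\<xi>. snd (g w) c = \<xi> c \<and> (fst (g 0), \<xi>) \<in> L" by blast
  qed
  then have "finite ((\<lambda>w. snd (g w) c) ` ball 0 r)"
    using finite_fibres[OF p(1) p(3)[OF 0]] finite_subset by blast
  moreover have "inj_on (\<lambda>w. snd (g w) c) (ball 0 r)"
  proof (rule inj_onI)
    fix v w assume vw: "v \<in> ball 0 r" "w \<in> ball 0 r" "snd (g v) c = snd (g w) c"
    have L: "L \<subseteq> cotangent S"
      by (rule conjunct1[OF Lagrangian[unfolded Lagrangian_submanifold_def]])
    have "cot_coord c (g v) = cot_coord c (g w)"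
      using vw const by (simp add: cot_coord_def case_prod_beta)
    then have "g v = g w"
      using vw L p(3,5) by (intro inj_onD[OF cot_coord_inj[OF curve p(1)]]) blast+
    then show "v = w" using inj_onD[OF p(6)] vw by blast
  qed
  ultimately have "finite (ball (0::complex) r)" using finite_imageD by blast
  then show False using p(2) uncountable_ball countable_finite by blast
qed

text \<open>A zero derivative means that the projection takes its value with multiplicity at least
  2, which is what \<open>branching_points\<close> records. Nonconstancy enters because otherwise
  \<open>zorder\<close> would not be an order of vanishing.\<close>

lemma unbranched_projection:
  assumes P: "local_parametrization S L c r g" and g0: "g 0 \<notin> branching_points S L"
  shows "deriv (\<lambda>w. coord c (fst (g w))) 0 \<noteq> 0"
proof
  note p = parametrizationD[OF P]
  let ?z = "\<lambda>w. coord c (fst (g w))"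
  assume d0: "deriv ?z 0 = 0"
  define k where "k w = ?z w - ?z 0" for w
  have 0: "(0::complex) \<in> ball 0 r" using p(2) by simp
  have hol: "k holomorphic_on ball 0 r"
    unfolding k_def by (intro holomorphic_intros p)
  have nc: "\<exists>w\<in>ball 0 r. k w \<noteq> 0"
    using projection_not_constant[OF P] by (simp add: k_def)
  have k0: "k 0 = 0" by (simp add: k_def)
  have "(?z has_field_derivative deriv ?z 0) (at 0)"
    using 0 by (intro holomorphic_derivI[OF p(9)]) auto
  then have dk: "(k has_field_derivative 0) (at 0)"
    unfolding k_def d0 using DERIV_diff[OF _ DERIV_const] by fastforce
  let ?n = "zorder k 0" and ?h = "zor_poly k 0"
  from zorder_exist_zero[OF hol open_ball connected_ball 0 nc] k0
  obtain \<rho> where n: "?n > 0" and \<rho>: "\<rho> > 0" "?h holomorphic_on cball 0 \<rho>"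
    "\<And>w. w \<in> cball 0 \<rho> \<Longrightarrow> k w = ?h w * w ^ nat ?n \<and> ?h w \<noteq> 0"
    by auto
  \<comment> \<open>At order 1 the derivative at 0 would be the nonzero number
    \<open>?h 0\<close>.\<close>
  have "?n \<noteq> 1"
  proof
    assume n1: "?n = 1"
    have "(?h has_field_derivative deriv ?h 0) (at 0)"
      using \<rho>(1) holomorphic_on_subset[OF \<rho>(2) ball_subset_cball]
      by (intro holomorphic_derivI[OF _ open_ball]) auto
    from DERIV_mult[OF this DERIV_ident]
    have "((\<lambda>w. ?h w * w) has_field_derivative ?h 0) (at 0)" by simp
    moreover have "\<forall>\<^sub>F w in nhds 0. ?h w * w = k w"
    proof -
      have "\<forall>\<^sub>F w in nhds 0. w \<in> ball 0 \<rho>"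
        using \<rho>(1) by (intro eventually_nhds_in_open) auto
      then show ?thesis by eventually_elim (use \<rho>(3) n1 in auto)
    qed
    ultimately have "(k has_field_derivative ?h 0) (at 0)"
      by (subst (asm) DERIV_cong_ev[OF refl _ refl])
    with dk have "?h 0 = 0" using DERIV_unique by blast
    then show False using \<rho>(3)[of 0] \<rho>(1) by auto
  qed
  with n have "?n > 1" by simp
  moreover have "branching_order S L (g 0) ?n"
    unfolding branching_order_def k_def using P
    by (intro exI[of _ c] exI[of _ r] exI[of _ g]) (simp add: cot_coord_def case_prod_beta)
  moreover have "g 0 \<in> L" using p(5) 0 by blast
  ultimately show False using g0 unfolding branching_points_def by blast
qed

text \<open>Off the branching points the base coordinate is a coordinate on \<open>L\<close>, so the
  section, given only as a continuous one, is differentiable along with \<gamma>; then the chain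
  rule applies.\<close>

lemma primitive_along_curve:
  assumes F: "primitive U F" and \<gamma>: "smooth_immersed_curve S \<gamma>" and s: "section_along S L \<gamma> s"
    and t: "t \<in> {0<..<1}" "(\<gamma> t, s t) \<in> U" "(\<gamma> t, s t) \<notin> branching_points S L"
    and c: "c \<in> atlas S" "\<gamma> t \<in> dom_of c"
  shows "((\<lambda>\<tau>. F (\<gamma> \<tau>, s \<tau>)) has_vector_derivative
           s t c * vector_derivative (coord c \<circ> \<gamma>) (at t)) (at t)"
proof -
  have sc: "continuous_map (top_of_set {0<..<1}) (cot_top S) (\<lambda>\<tau>. (\<gamma> \<tau>, s \<tau>))"
    and sL: "(\<lambda>\<tau>. (\<gamma> \<tau>, s \<tau>)) ` {0<..<1} \<subseteq> L"
    using s unfolding section_along_def by blast+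
  have D: "((coord d \<circ> \<gamma>) has_vector_derivative vector_derivative (coord d \<circ> \<gamma>) (at t)) (at t)"
    if "d \<in> atlas S" "\<gamma> t \<in> dom_of d" for d
  proof -
    have "smooth_on {\<tau>\<in>{0<..<1}. \<gamma> \<tau> \<in> dom_of d} (coord d \<circ> \<gamma>)"
      using \<gamma> that unfolding smooth_immersed_curve_def by blast
    then obtain e where e: "e 0 = coord d \<circ> \<gamma>"
      "\<forall>n. \<forall>\<tau>\<in>{\<tau>\<in>{0<..<1}. \<gamma> \<tau> \<in> dom_of d}. (e n has_vector_derivative e (Suc n) \<tau>) (at \<tau>)"
      unfolding smooth_on_def by blast
    then have "(e 0 has_vector_derivative e (Suc 0) t) (at t)"
      using that t(1) by blast
    then show ?thesis unfolding e(1) by (simp only: vector_derivative_at)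
  qed
  obtain d r g where P: "local_parametrization S L d r g" and g0: "g 0 = (\<gamma> t, s t)"
    using centred_parametrization[of "(\<gamma> t, s t)"] sL t(1) by blast
  note p = parametrizationD[OF P]
  let ?\<phi> = "\<lambda>\<tau>. inv_into (ball 0 r) g (\<gamma> \<tau>, s \<tau>)" and ?z = "\<lambda>w. coord d (fst (g w))"
  let ?v = "vector_derivative (coord d \<circ> \<gamma>) (at t)"
  have 0: "(0::complex) \<in> ball 0 r" using p(2) by simp
  have \<gamma>d: "\<gamma> t \<in> dom_of d" using p(3)[OF 0] g0 by simp
  have \<phi>t: "?\<phi> t = 0" using g0 inv_into_f_f[OF p(6) 0] by simp
  have in_g: "(\<gamma> t, s t) \<in> g ` ball 0 r" using g0 0 by (metis imageI)
  have z0: "deriv ?z (?\<phi> t) \<noteq> 0"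
    using unbranched_projection[OF P] t(3) g0 \<phi>t by simp
  have cont: "isCont ?\<phi> t"
    using p(8) by (intro isCont_on_L[OF sc _ sL t(1) p(4) in_g]) (auto simp: continuous_map_in_subtopology)
  have ev: "\<forall>\<^sub>F \<tau> in nhds t. g (?\<phi> \<tau>) = (\<gamma> \<tau>, s \<tau>)"
    using continuous_eventually_in[OF sc _ sL t(1) p(4) in_g]
    by (auto elim!: eventually_mono intro: f_inv_into_f)
  have "\<forall>\<^sub>F \<tau> in nhds t. (coord d \<circ> \<gamma>) \<tau> = ?z (?\<phi> \<tau>)"
    using ev by (auto elim!: eventually_mono)
  then have "((\<lambda>\<tau>. ?z (?\<phi> \<tau>)) has_vector_derivative ?v) (at t)"
    using D[OF p(1) \<gamma>d] eventually_nhds_x_imp_x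
    by (subst (asm) has_vector_derivative_cong_ev[where g="\<lambda>\<tau>. ?z (?\<phi> \<tau>)"]) (auto elim!: eventually_mono)
  then have D\<phi>: "(?\<phi> has_vector_derivative ?v / deriv ?z (?\<phi> t)) (at t)"
    using \<phi>t 0 z0 cont by (intro vector_derivative_lift[OF p(9) open_ball]) auto
  have "((\<lambda>w. F (g w)) has_field_derivative snd (g 0) d * deriv ?z 0) (at 0)"
    using primitiveD(3)[OF F P 0] g0 t(2) by simp
  then have "((\<lambda>w. F (g w)) has_field_derivative s t d * deriv ?z (?\<phi> t)) (at (?\<phi> t))"
    using \<phi>t g0 by simp
  from field_vector_diff_chain_at[OF D\<phi> this] z0
  have "((\<lambda>\<tau>. F (g (?\<phi> \<tau>))) has_vector_derivative s t d * ?v) (at t)"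
    by (simp add: o_def mult.commute)
  moreover have "\<forall>\<^sub>F \<tau> in nhds t. F (g (?\<phi> \<tau>)) = F (\<gamma> \<tau>, s \<tau>)"
    using ev by (auto elim!: eventually_mono)
  ultimately have "((\<lambda>\<tau>. F (\<gamma> \<tau>, s \<tau>)) has_vector_derivative s t d * ?v) (at t)"
    using eventually_nhds_x_imp_x
    by (subst (asm) has_vector_derivative_cong_ev[where g="\<lambda>\<tau>. F (\<gamma> \<tau>, s \<tau>)"]) (auto elim!: eventually_mono)
  \<comment> \<open>The parametrization of \<open>L\<close> brings its own chart \<open>d\<close>,
    in general different from \<open>c\<close>.\<close>
  moreover have "s t d * ?v = s t c * vector_derivative (coord c \<circ> \<gamma>) (at t)"
  proof (rule difference_form_chart_independent[where \<gamma>=\<gamma> and t=t, OF curve p(1) c(1) \<gamma>d c(2)])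
    show "s t \<in> canonical_fibre S 1 (\<gamma> t)" using in_fibre sL t(1) by blast
    show "continuous_map (top_of_set {0<..<1}) (surf_top S) \<gamma>"
      using \<gamma> unfolding smooth_immersed_curve_def by blast
  qed (use t D[OF p(1) \<gamma>d] in auto)
  ultimately show ?thesis by simp
qed

end

section \<open>Countability of the periods\<close>

text \<open>Countability comes from the compact base: finitely many charts cover the surface, and
  over each of them \<open>cot_coord\<close> identifies the cotangent bundle with a subset of C x C,
  where families of open sets have countable subfamilies with the same union. \<open>N\<close> will
  be \<open>L\<close> or an overlap of pieces of it, which need not be compact.\<close>

lemma cotangent_Lindelof:
  assumes S: "complex_curve S" "compact_space (surf_top S)" and N: "N \<subseteq> cotangent S"
    and W: "\<And>p. p \<in> N \<Longrightarrow> cot_open S (W p) \<and> p \<in> W p"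
  obtains A where "A \<subseteq> N" "countable A" "N \<subseteq> \<Union> (W ` A)"
proof -
  have cov: "\<Union> (dom_of ` atlas S) = points S" using S(1) unfolding complex_curve_def by blast
  have "\<forall>U \<in> dom_of ` atlas S. openin (surf_top S) U"
    using open_dom[OF S(1)] by blast
  then obtain \<F> where "finite \<F>" "\<F> \<subseteq> dom_of ` atlas S" "points S \<subseteq> \<Union>\<F>"
    using S(2) cov unfolding compact_space_alt by (metis order_refl)
  then obtain C where C: "finite C" "C \<subseteq> atlas S" "points S \<subseteq> \<Union> (dom_of ` C)"
    by (metis finite_subset_image)
  define I where "I c p = cot_coord c ` {q \<in> W p. fst q \<in> dom_of c}" for c p
  have "\<exists>A\<subseteq>N. countable A \<and> \<Union> (I c ` A) = \<Union> (I c ` N)" if c: "c \<in> C" for c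
  proof -
    have "open U" if "U \<in> I c ` N" for U
      using that W c C(2) unfolding I_def cot_open_def by blast
    then obtain \<F>' where "\<F>' \<subseteq> I c ` N" "countable \<F>'" "\<Union>\<F>' = \<Union> (I c ` N)"
      using Lindelof[of "I c ` N"] by blast
    then show ?thesis by (metis countable_subset_image)
  qed
  then obtain A where A: "\<And>c. c \<in> C \<Longrightarrow> A c \<subseteq> N \<and> countable (A c) \<and> \<Union> (I c ` A c) = \<Union> (I c ` N)"
    by metis
  have "N \<subseteq> \<Union> (W ` (\<Union>c\<in>C. A c))"
  proof
    fix q assume q: "q \<in> N"
    then have "fst q \<in> points S" using N by (auto simp: cotangent_def)
    then obtain c where c: "c \<in> C" "fst q \<in> dom_of c" using C(3) by blast
    have "cot_coord c q \<in> \<Union> (I c ` N)"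
      using W[OF q] q c(2) unfolding I_def by blast
    then have "cot_coord c q \<in> \<Union> (I c ` A c)" using A[OF c(1)] by simp
    then obtain p q' where p: "p \<in> A c" and q': "q' \<in> W p" "fst q' \<in> dom_of c" "cot_coord c q = cot_coord c q'"
      unfolding I_def by blast
    have "W p \<subseteq> cotangent S"
      using A[OF c(1)] p W unfolding cot_open_def by blast
    then have "q = q'"
      using q q' c N C(2) by (intro inj_onD[OF cot_coord_inj[OF S(1)] q'(3)]) blast+
    then show "q \<in> \<Union> (W ` (\<Union>c\<in>C. A c))" using p q' c(1) by blast
  qed
  moreover have "(\<Union>c\<in>C. A c) \<subseteq> N"
    using A by blast
  moreover have "countable (\<Union>c\<in>C. A c)"
    by (rule countable_UN[OF countable_finite[OF C(1)]]) (use A in blast)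
  ultimately show thesis using that by blast
qed

text \<open>Countably many of the neighbourhoods cover \<open>N\<close>, and each contributes a
  single value.\<close>

lemma countable_image_locally_constant:
  assumes S: "complex_curve S" "compact_space (surf_top S)" and N: "N \<subseteq> cotangent S"
    and f: "\<And>p. p \<in> N \<Longrightarrow> \<exists>W. cot_open S W \<and> p \<in> W \<and> (\<forall>q\<in>W \<inter> N. f q = f p)"
  shows "countable (f ` N)"
proof -
  obtain W where W: "\<And>p. p \<in> N \<Longrightarrow> cot_open S (W p) \<and> p \<in> W p \<and> (\<forall>q\<in>W p \<inter> N. f q = f p)"
    using f by metis
  then obtain A where A: "A \<subseteq> N" "countable A" "N \<subseteq> \<Union> (W ` A)"
    using cotangent_Lindelof[OF S N, of W] by metis
  have "f ` N \<subseteq> f ` A"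
  proof safe
    fix q assume "q \<in> N"
    then obtain p where "p \<in> A" "q \<in> W p" using A(3) by blast
    then have "f q = f p" using W A(1) \<open>q \<in> N\<close> by blast
    then show "f q \<in> f ` A" using \<open>p \<in> A\<close> by blast
  qed
  then show ?thesis by (rule countable_subset[OF _ countable_image[OF A(2)]])
qed

section \<open>Countable subgroups of the complex numbers\<close>

definition additive_subgroup :: "complex set \<Rightarrow> bool" where
  "additive_subgroup G \<longleftrightarrow> 0 \<in> G \<and> (\<forall>a\<in>G. \<forall>b\<in>G. a + b \<in> G) \<and> (\<forall>a\<in>G. - a \<in> G)"

lemma additive_subgroupD:
  assumes "additive_subgroup G"
  shows "0 \<in> G" "a \<in> G \<Longrightarrow> b \<in> G \<Longrightarrow> a + b \<in> G" "a \<in> G \<Longrightarrow> - a \<in> G"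
    "a \<in> G \<Longrightarrow> b \<in> G \<Longrightarrow> a - b \<in> G"
proof -
  show 0: "0 \<in> G" and plus: "a \<in> G \<Longrightarrow> b \<in> G \<Longrightarrow> a + b \<in> G" and minus: "a \<in> G \<Longrightarrow> - a \<in> G" for a b
    using assms unfolding additive_subgroup_def by blast+
  show "a - b \<in> G" if "a \<in> G" "b \<in> G"
    using plus[OF that(1) minus[OF that(2)]] by simp
qed

lemma additive_subgroup_sum:
  assumes "additive_subgroup G" "\<And>i. i \<in> I \<Longrightarrow> f i \<in> G"
  shows "sum f I \<in> G"
  using assms(2)
  by (induction I rule: infinite_finite_induct) (simp_all add: additive_subgroupD(1,2)[OF assms(1)])

text \<open>The generated group consists of the sums of finite lists of elements and their
  negatives, and a countable set has only countably many finite lists.\<close>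

lemma countable_additive_subgroup:
  assumes "countable V"
  obtains G where "V \<subseteq> G" "countable G" "additive_subgroup G"
proof
  let ?G = "sum_list ` lists (V \<union> uminus ` V)"
  show "V \<subseteq> ?G"
  proof
    fix v assume "v \<in> V"
    then show "v \<in> ?G" by (intro image_eqI[of _ _ "[v]"]) auto
  qed
  show "countable ?G" using assms by blast
  show "additive_subgroup ?G"
    unfolding additive_subgroup_def
  proof (intro conjI ballI)
    show "0 \<in> ?G" by (intro image_eqI[of _ _ "[]"]) auto
    fix a assume "a \<in> ?G"
    then obtain xs where xs: "xs \<in> lists (V \<union> uminus ` V)" "a = sum_list xs" by blast
    show "- a \<in> ?G"
    proof (intro image_eqI)
      show "- a = sum_list (map uminus xs)"
        unfolding xs(2) by (induction xs) auto
      show "map uminus xs \<in> lists (V \<union> uminus ` V)"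
        using xs(1) by (auto simp: in_lists_conv_set image_iff)
    qed
    fix b assume "b \<in> ?G"
    then obtain ys where ys: "ys \<in> lists (V \<union> uminus ` V)" "b = sum_list ys" by blast
    show "a + b \<in> ?G"
      using xs ys by (intro image_eqI[of _ _ "xs @ ys"]) auto
  qed
qed

context Lagrangian_curve
begin

text \<open>On overlaps two primitives differ by a locally constant function, so countably many primitives
  produce only countably many differences; \<open>G\<close> is the group generated by these.\<close>

lemma primitive_modulo_periods:
  assumes comp: "compact_space (surf_top S)"
  obtains G F where "countable G" "additive_subgroup G"
    "\<And>p. p \<in> L \<Longrightarrow> \<exists>U P. primitive U P \<and> p \<in> U \<and> (\<forall>q\<in>U. F q - P q \<in> G)"
proof -
  have L: "L \<subseteq> cotangent S"
    by (rule conjunct1[OF Lagrangian[unfolded Lagrangian_submanifold_def]])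
  have "\<exists>U P. primitive U P \<and> p \<in> U" if "p \<in> L" for p
    using primitive_exists[OF that] by metis
  then obtain U P where UP: "\<And>p. p \<in> L \<Longrightarrow> primitive (U p) (P p) \<and> p \<in> U p"
    by metis
  have opn: "\<exists>W. cot_open S W \<and> V = W \<inter> L" if "open_in_L V" for V
    using that unfolding openin_subtopology openin_cot_top[OF curve] by blast
  have "\<exists>W. cot_open S W \<and> U p = W \<inter> L" if "p \<in> L" for p
    using opn primitiveD(1) UP[OF that] by blast
  then obtain W where W: "\<And>p. p \<in> L \<Longrightarrow> cot_open S (W p) \<and> U p = W p \<inter> L"
    by metis
  obtain A where A: "A \<subseteq> L" "countable A" "L \<subseteq> \<Union> (W ` A)"
  proof (rule cotangent_Lindelof[OF curve comp L, of W])
    show "cot_open S (W p) \<and> p \<in> W p" if "p \<in> L" for p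
      using W[OF that] UP[OF that] by blast
  qed
  have "\<exists>a. a \<in> A \<and> p \<in> U a" if "p \<in> L" for p
    using A(1,3) W that by blast
  \<comment> \<open>\<open>a\<close> selects one of the countably many primitives for each point,
    with no continuity. The \<open>F\<close> obtained at the end is
    \<open>\<lambda>q. P (a q) q\<close>; its jumps caused by changes of the selection lie in the
    set \<open>V\<close> defined next.\<close>
  then obtain a where a: "\<And>p. p \<in> L \<Longrightarrow> a p \<in> A \<and> p \<in> U (a p)"
    by metis
  define V where "V = (\<Union>(b, b') \<in> A \<times> A. (\<lambda>q. P b q - P b' q) ` (U b \<inter> U b'))"
  have "countable ((\<lambda>q. P b q - P b' q) ` (U b \<inter> U b'))" if b: "b \<in> A" "b' \<in> A" for b b'
  proof (rule countable_image_locally_constant[OF curve comp])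
    show "U b \<inter> U b' \<subseteq> cotangent S" using W A(1) L b by blast
    fix p assume "p \<in> U b \<inter> U b'"
    then obtain Z where Z: "open_in_L Z" "p \<in> Z"
      "\<And>q. q \<in> Z \<Longrightarrow> q \<in> U b \<and> q \<in> U b' \<and> P b q - P b' q = P b p - P b' p"
      using primitive_difference_locally_constant[of "U b" "P b" "U b'" "P b'" p] UP b A(1) by blast
    then obtain T where T: "cot_open S T" "Z = T \<inter> L" using opn by blast
    have "\<forall>q\<in>T \<inter> (U b \<inter> U b'). P b q - P b' q = P b p - P b' p"
      using Z(3) T(2) W b A(1) by blast
    then show "\<exists>T. cot_open S T \<and> p \<in> T \<and>
        (\<forall>q\<in>T \<inter> (U b \<inter> U b'). P b q - P b' q = P b p - P b' p)"
      using T Z(2) by blast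
  qed
  then have "countable V"
    unfolding V_def using A(2) by (intro countable_UN) auto
  then obtain G where G: "V \<subseteq> G" "countable G" "additive_subgroup G"
    using countable_additive_subgroup by blast
  show thesis
  proof (rule that[OF G(2,3)])
    fix p assume p: "p \<in> L"
    have "P (a q) q - P (a p) q \<in> G" if q: "q \<in> U (a p)" for q
    proof -
      have "q \<in> L" using q W a[OF p] A(1) by blast
      then have "P (a q) q - P (a p) q \<in> V"
        unfolding V_def using a[OF p] a[of q] q by (intro UN_I[of "(a q, a p)"]) auto
      then show ?thesis using G(1) by blast
    qed
    then show "\<exists>U P'. primitive U P' \<and> p \<in> U \<and> (\<forall>q\<in>U. P (a q) q - P' q \<in> G)"
      using UP a[OF p] A(1) by blast
  qed
qed

end

section \<open>Increments along preStokes curves\<close>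

text \<open>The sections of a preStokes curve live on the open interval, and the sheets prescribed
  at the vertices are limits. Filling these in gives a continuous map on a compact interval, to
  which a bisection argument applies.\<close>

lemma continuous_map_one_sided_limits:
  fixes f :: "real \<Rightarrow> 'b"
  assumes f: "continuous_map (top_of_set {0<..<1}) X f"
    and p: "limitin X f p (at_right 0)" and q: "limitin X f q (at_left 1)"
  shows "continuous_map (top_of_set {0..1}) X (\<lambda>t. if t = 0 then p else if t = 1 then q else f t)"
    (is "continuous_map _ _ ?f")
  unfolding continuous_map
proof (intro conjI allI impI)
  have "f t \<in> topspace X" if "0 < t" "t < 1" for t
    using continuous_map_image_subset_topspace[OF f] that by auto
  then show "?f ` topspace (top_of_set {0..1}) \<subseteq> topspace X"
    using limitin_topspace[OF p] limitin_topspace[OF q] by auto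
  fix T assume T: "openin X T"
  have "\<exists>e>0. \<forall>y\<in>{0..1}. dist y x < e \<longrightarrow> ?f y \<in> T" if x: "x \<in> {0..1}" "?f x \<in> T" for x
  proof -
    consider "x = 0" | "x = 1" | "0 < x" "x < 1" using x(1) by fastforce
    then show ?thesis
    proof cases
      case 1
      then have "\<forall>\<^sub>F t in at_right 0. f t \<in> T"
        using limitinD[OF p T] x(2) by simp
      then obtain b where "b > 0" "\<And>t. 0 < t \<Longrightarrow> t < b \<Longrightarrow> f t \<in> T"
        unfolding eventually_at_right_field by auto
      then show ?thesis using x(2) unfolding 1
        by (intro exI[of _ "min b 1"]) (auto simp: dist_real_def)
    next
      case 2
      then have "\<forall>\<^sub>F t in at_left 1. f t \<in> T"
        using limitinD[OF q T] x(2) by simp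
      then obtain b where "b < 1" "\<And>t. b < t \<Longrightarrow> t < 1 \<Longrightarrow> f t \<in> T"
        unfolding eventually_at_left_field by auto
      then show ?thesis using x(2) unfolding 2
        by (intro exI[of _ "min (1 - b) 1"]) (auto simp: dist_real_def)
    next
      case 3
      have "openin (top_of_set {0<..<1}) {t \<in> {0<..<1}. f t \<in> T}"
        using openin_continuous_map_preimage[OF f T] by simp
      then have "open {t \<in> {0<..<1}. f t \<in> T}"
        using openin_open_trans open_greaterThanLessThan by blast
      moreover have "x \<in> {t \<in> {0<..<1}. f t \<in> T}" using 3 x(2) by simp
      ultimately obtain e where "e > 0" "\<And>y. dist y x < e \<Longrightarrow> y \<in> {t \<in> {0<..<1}. f t \<in> T}"
        unfolding open_dist by blast
      then show ?thesis by (intro exI[of _ e]) fastforce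
    qed
  qed
  then show "openin (top_of_set {0..1}) {x \<in> topspace (top_of_set {0..1}). ?f x \<in> T}"
    unfolding openin_euclidean_subtopology_iff by auto
qed

context spectral_Lagrangian
begin

text \<open>The increment of \<open>F \<circ> s\<^sub>1 - F \<circ> s\<^sub>2\<close> stands for the integral of \<open>\<lambda>\<^sub>1 - \<lambda>\<^sub>2\<close>. Working modulo \<open>G\<close>,
  it can be computed on small intervals with local primitives, so no integral is needed.\<close>

lemma preStokes_increment:
  assumes G: "additive_subgroup G"
    and F: "\<And>p. p \<in> L \<Longrightarrow> \<exists>U P. primitive U P \<and> p \<in> U \<and> (\<forall>q\<in>U. F q - P q \<in> G)"
    and \<gamma>: "preStokes_curve S D L \<theta> \<gamma> s\<^sub>1 s\<^sub>2"
    and p: "limitin (cot_top S) (\<lambda>t. (\<gamma> t, s\<^sub>1 t)) p\<^sub>1 (at_right 0)" "limitin (cot_top S) (\<lambda>t. (\<gamma> t, s\<^sub>2 t)) p\<^sub>2 (at_right 0)"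
    and q: "limitin (cot_top S) (\<lambda>t. (\<gamma> t, s\<^sub>1 t)) q\<^sub>1 (at_left 1)" "limitin (cot_top S) (\<lambda>t. (\<gamma> t, s\<^sub>2 t)) q\<^sub>2 (at_left 1)"
    and L: "p\<^sub>1 \<in> L" "p\<^sub>2 \<in> L" "q\<^sub>1 \<in> L" "q\<^sub>2 \<in> L"
  shows "\<exists>r>0. F q\<^sub>1 - F q\<^sub>2 - (F p\<^sub>1 - F p\<^sub>2) - of_real r * exp (2 * of_real pi * \<i> * of_real \<theta>) \<in> G"
proof -
  define u where "u = exp (2 * complex_of_real pi * \<i> * of_real \<theta>)"
  have u: "exp (- 2 * complex_of_real pi * \<i> * of_real \<theta>) = inverse u" "u \<noteq> 0"
    by (simp_all add: u_def exp_minus)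
  have sm: "smooth_immersed_curve S \<gamma>" and s: "section_along S L \<gamma> s\<^sub>1" "section_along S L \<gamma> s\<^sub>2"
    and \<gamma>S: "\<And>t. t \<in> {0<..<1} \<Longrightarrow> \<gamma> t \<in> points S"
    and nb: "\<And>t. t \<in> {0<..<1} \<Longrightarrow> (\<gamma> t, s\<^sub>1 t) \<notin> branching_points S L"
      "\<And>t. t \<in> {0<..<1} \<Longrightarrow> (\<gamma> t, s\<^sub>2 t) \<notin> branching_points S L"
    using \<gamma> unfolding preStokes_curve_def by blast+
  have pos: "Im (inverse u * difference_form c \<gamma> s\<^sub>1 s\<^sub>2 t) = 0" "Re (inverse u * difference_form c \<gamma> s\<^sub>1 s\<^sub>2 t) > 0"
    if "t \<in> {0<..<1}" "c \<in> atlas S" "\<gamma> t \<in> dom_of c" for t c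
    using \<gamma> that unfolding preStokes_curve_def u(1) by blast+
  define \<sigma>\<^sub>1 where "\<sigma>\<^sub>1 t = (if t = 0 then p\<^sub>1 else if t = 1 then q\<^sub>1 else (\<gamma> t, s\<^sub>1 t))" for t
  define \<sigma>\<^sub>2 where "\<sigma>\<^sub>2 t = (if t = 0 then p\<^sub>2 else if t = 1 then q\<^sub>2 else (\<gamma> t, s\<^sub>2 t))" for t
  have \<sigma>L: "\<sigma>\<^sub>1 t \<in> L" "\<sigma>\<^sub>2 t \<in> L" if "t \<in> {0..1}" for t
    using that L s unfolding section_along_def \<sigma>\<^sub>1_def \<sigma>\<^sub>2_def by auto
  have "continuous_map (top_of_set {0..1}) (cot_top S) \<sigma>\<^sub>1" "continuous_map (top_of_set {0..1}) (cot_top S) \<sigma>\<^sub>2"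
    unfolding \<sigma>\<^sub>1_def \<sigma>\<^sub>2_def using s p q
    by (intro continuous_map_one_sided_limits; simp add: section_along_def)+
  then have cont: "continuous_map (top_of_set {0..1}) (subtopology (cot_top S) L) \<sigma>\<^sub>1"
    "continuous_map (top_of_set {0..1}) (subtopology (cot_top S) L) \<sigma>\<^sub>2"
    using \<sigma>L by (auto simp: continuous_map_in_subtopology)
  have near: "\<exists>d>0. \<forall>t\<in>{0..1}. dist t x < d \<longrightarrow> \<sigma> t \<in> U"
    if "continuous_map (top_of_set {0..1}) (subtopology (cot_top S) L) \<sigma>"
      "open_in_L U" "x \<in> {0..1}" "\<sigma> x \<in> U" for \<sigma> U and x :: real
  proof -
    have "openin (top_of_set {0..1}) {t \<in> {0..1}. \<sigma> t \<in> U}"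
      using openin_continuous_map_preimage[OF that(1,2)] by simp
    then show ?thesis
      using that(3,4) unfolding openin_euclidean_subtopology_iff by blast
  qed
  have comp_cont: "continuous_on {a..b} (\<lambda>t. P (\<sigma> t))"
    if "continuous_map (top_of_set {0..1}) (subtopology (cot_top S) L) \<sigma>" "primitive U P"
      "{a..b} \<subseteq> {0..1}" "\<sigma> ` {a..b} \<subseteq> U" for \<sigma> U P and a b :: real
  proof -
    have "continuous_map (top_of_set {0..1}) (cot_top S) \<sigma>"
      using that(1) by (simp add: continuous_map_in_subtopology)
    then have "continuous_map (top_of_set {a..b}) (subtopology (cot_top S) U) \<sigma>"
      using that(4) continuous_map_from_subtopology_mono[OF _ that(3)]
      by (simp add: continuous_map_in_subtopology image_subset_iff_funcset)
    from continuous_map_compose[OF this primitiveD(2)[OF that(2)]]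
    show ?thesis by (simp add: o_def)
  qed
  define \<Delta> where "\<Delta> t = F (\<sigma>\<^sub>1 t) - F (\<sigma>\<^sub>2 t)" for t
  \<comment> \<open>Requiring \<open>a < b\<close> allows \<open>r\<close> to be strictly positive,
    and \<open>Q\<close> is vacuous for the other intervals over which \<open>Bolzano\<close>
    quantifies.\<close>
  define Q where "Q a b \<longleftrightarrow> (0 \<le> a \<and> b \<le> 1 \<and> a < b \<longrightarrow> (\<exists>r>0. \<Delta> b - \<Delta> a - of_real r * u \<in> G))" for a b
  have "Q 0 1"
  \<comment> \<open>Bisection: the property adds up over adjacent intervals and holds on all short
    intervals around a given point, so no subdivision has to be chosen.\<close>
  proof (rule Bolzano)
    fix a b c assume Q: "Q a b" "Q b c" and le: "a \<le> b" "b \<le> c"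
    show "Q a c"
    proof (cases "a = b \<or> b = c")
      case False
      show ?thesis
        unfolding Q_def
      proof
        assume "0 \<le> a \<and> c \<le> 1 \<and> a < c"
        then obtain r r' where r: "r > 0" "\<Delta> b - \<Delta> a - of_real r * u \<in> G"
          and r': "r' > 0" "\<Delta> c - \<Delta> b - of_real r' * u \<in> G"
          using Q le False unfolding Q_def by force
        have "\<Delta> c - \<Delta> a - of_real (r + r') * u =
            (\<Delta> b - \<Delta> a - of_real r * u) + (\<Delta> c - \<Delta> b - of_real r' * u)"
          by (simp add: algebra_simps)
        also have "\<dots> \<in> G" by (rule additive_subgroupD(2)[OF G r(2) r'(2)])
        finally show "\<exists>r>0. \<Delta> c - \<Delta> a - of_real r * u \<in> G"
          using r(1) r'(1) by (intro exI[of _ "r + r'"]) simp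
      qed
    qed (use Q in auto)
  next
    fix x :: real assume "0 \<le> x" "x \<le> 1"
    then have x: "x \<in> {0..1}" by simp
    obtain U P where U: "primitive U P" "\<sigma>\<^sub>1 x \<in> U" "\<And>q. q \<in> U \<Longrightarrow> F q - P q \<in> G"
      using F[OF \<sigma>L(1)[OF x]] by blast
    obtain V R where V: "primitive V R" "\<sigma>\<^sub>2 x \<in> V" "\<And>q. q \<in> V \<Longrightarrow> F q - R q \<in> G"
      using F[OF \<sigma>L(2)[OF x]] by blast
    obtain d\<^sub>1 d\<^sub>2 where d\<^sub>1: "d\<^sub>1 > 0" "\<forall>t\<in>{0..1}. dist t x < d\<^sub>1 \<longrightarrow> \<sigma>\<^sub>1 t \<in> U"
      and d\<^sub>2: "d\<^sub>2 > 0" "\<forall>t\<in>{0..1}. dist t x < d\<^sub>2 \<longrightarrow> \<sigma>\<^sub>2 t \<in> V"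
      using near[OF cont(1) primitiveD(1)[OF U(1)] x U(2)]
        near[OF cont(2) primitiveD(1)[OF V(1)] x V(2)] by blast
    have "Q a b" if ab: "a \<le> x" "x \<le> b" "b - a < min d\<^sub>1 d\<^sub>2" for a b
      unfolding Q_def
    proof
      assume ab': "0 \<le> a \<and> b \<le> 1 \<and> a < b"
      have in01: "{a..b} \<subseteq> {0..1}" using ab' by auto
      have inU: "\<sigma>\<^sub>1 t \<in> U" and inV: "\<sigma>\<^sub>2 t \<in> V" if "t \<in> {a..b}" for t
      proof -
        have "t \<in> {0..1}" "dist t x < d\<^sub>1" "dist t x < d\<^sub>2"
          using that in01 ab by (auto simp: dist_real_def)
        then show "\<sigma>\<^sub>1 t \<in> U" "\<sigma>\<^sub>2 t \<in> V" using d\<^sub>1(2) d\<^sub>2(2) by blast+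
      qed
      \<comment> \<open>Division by \<open>u\<close> turns the preStokes condition into a derivative
        that is real and positive.\<close>
      define H where "H t = inverse u * (P (\<sigma>\<^sub>1 t) - R (\<sigma>\<^sub>2 t))" for t
      have Hc: "continuous_on {a..b} H"
        unfolding H_def
        by (intro continuous_intros comp_cont[OF cont(1) U(1) in01] comp_cont[OF cont(2) V(1) in01])
           (use inU inV in blast)+
      have HD: "\<exists>y>0. (H has_vector_derivative of_real y) (at t)" if t: "a < t" "t < b" for t
      proof -
        have t01: "t \<in> {0<..<1}" using t ab' by auto
        have "\<Union> (dom_of ` atlas S) = points S" using curve unfolding complex_curve_def by blast
        then obtain c where c: "c \<in> atlas S" "\<gamma> t \<in> dom_of c" using \<gamma>S[OF t01] by blast
        have \<sigma>t: "\<sigma>\<^sub>1 \<tau> = (\<gamma> \<tau>, s\<^sub>1 \<tau>)" "\<sigma>\<^sub>2 \<tau> = (\<gamma> \<tau>, s\<^sub>2 \<tau>)" if "\<tau> \<in> {0<..<1}" for \<tau>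
          using that by (auto simp: \<sigma>\<^sub>1_def \<sigma>\<^sub>2_def)
        have in': "(\<gamma> t, s\<^sub>1 t) \<in> U" "(\<gamma> t, s\<^sub>2 t) \<in> V"
          using inU[of t] inV[of t] t \<sigma>t[OF t01] by auto
        have "((\<lambda>\<tau>. inverse u * (P (\<gamma> \<tau>, s\<^sub>1 \<tau>) - R (\<gamma> \<tau>, s\<^sub>2 \<tau>))) has_vector_derivative
            inverse u * (s\<^sub>1 t c * vector_derivative (coord c \<circ> \<gamma>) (at t) - s\<^sub>2 t c * vector_derivative (coord c \<circ> \<gamma>) (at t))) (at t)"
          by (intro has_vector_derivative_mult_right has_vector_derivative_diff
              primitive_along_curve[OF U(1) sm s(1) t01 in'(1) nb(1)[OF t01] c]
              primitive_along_curve[OF V(1) sm s(2) t01 in'(2) nb(2)[OF t01] c])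
        moreover have "inverse u * (s\<^sub>1 t c * vector_derivative (coord c \<circ> \<gamma>) (at t) - s\<^sub>2 t c * vector_derivative (coord c \<circ> \<gamma>) (at t))
            = of_real (Re (inverse u * difference_form c \<gamma> s\<^sub>1 s\<^sub>2 t))"
          using pos(1)[OF t01 c] by (simp add: difference_form_def complex_eq_iff algebra_simps)
        moreover have "\<forall>\<^sub>F \<tau> in nhds t. inverse u * (P (\<gamma> \<tau>, s\<^sub>1 \<tau>) - R (\<gamma> \<tau>, s\<^sub>2 \<tau>)) = H \<tau>"
        proof -
          have "\<forall>\<^sub>F \<tau> in nhds t. \<tau> \<in> {0<..<1}"
            using t01 by (intro eventually_nhds_in_open) auto
          then show ?thesis by eventually_elim (simp add: H_def \<sigma>t)
        qed
        ultimately have "(H has_vector_derivative of_real (Re (inverse u * difference_form c \<gamma> s\<^sub>1 s\<^sub>2 t))) (at t)"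
          using eventually_nhds_x_imp_x
          by (subst (asm) has_vector_derivative_cong_ev[where g=H]) (auto elim!: eventually_mono)
        then show ?thesis using pos(2)[OF t01 c] by blast
      qed
      \<comment> \<open>Only continuity is required at \<open>a\<close> and \<open>b\<close>; at the
        ends of the edge the lift may sit at a branching point and \<gamma> may fail to be
        differentiable.\<close>
      have "Re (H a) < Re (H b)"
      proof (rule DERIV_pos_imp_increasing_open[where f="\<lambda>t. Re (H t)"])
        fix t assume "a < t" "t < b"
        then obtain y where y: "y > 0" "(H has_vector_derivative of_real y) (at t)" using HD by blast
        have "((\<lambda>t. Re (H t)) has_real_derivative y) (at t)"
          using bounded_linear.has_vector_derivative[OF bounded_linear_Re y(2)]
          by (simp add: has_real_derivative_iff_has_vector_derivative)
        then show "\<exists>y. ((\<lambda>t. Re (H t)) has_real_derivative y) (at t) \<and> 0 < y" using y(1) by blast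
      qed (use ab' Hc in \<open>auto intro: continuous_on_Re\<close>)
      moreover have "Im (H b) = Im (H a)"
      proof (rule DERIV_isconst_end[where f="\<lambda>t. Im (H t)"])
        fix t assume "a < t" "t < b"
        then obtain y where y: "(H has_vector_derivative of_real y) (at t)" using HD by blast
        show "((\<lambda>t. Im (H t)) has_real_derivative 0) (at t)"
          using bounded_linear.has_vector_derivative[OF bounded_linear_Im y]
          by (simp add: has_real_derivative_iff_has_vector_derivative)
      qed (use ab' Hc in \<open>auto intro: continuous_on_Im\<close>)
      ultimately have r: "Re (H b - H a) > 0" "H b - H a = of_real (Re (H b - H a))"
        by (auto simp: complex_eq_iff)
      have uH: "u * H t = P (\<sigma>\<^sub>1 t) - R (\<sigma>\<^sub>2 t)" for t
        using u(2) by (simp add: H_def)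
      have "\<Delta> b - \<Delta> a - of_real (Re (H b - H a)) * u = \<Delta> b - \<Delta> a - (u * H b - u * H a)"
        using r(2) by (metis mult.commute right_diff_distrib)
      \<comment> \<open>\<open>P\<close> and \<open>R\<close> stay fixed on the whole interval, so
        the discrepancy consists of four errors, each in \<open>G\<close>.\<close>
      also have "\<dots> = (F (\<sigma>\<^sub>1 b) - P (\<sigma>\<^sub>1 b)) - (F (\<sigma>\<^sub>2 b) - R (\<sigma>\<^sub>2 b))
          - ((F (\<sigma>\<^sub>1 a) - P (\<sigma>\<^sub>1 a)) - (F (\<sigma>\<^sub>2 a) - R (\<sigma>\<^sub>2 a)))"
        unfolding uH \<Delta>_def by (simp add: algebra_simps)
      also have "\<dots> \<in> G"
        using ab' by (intro additive_subgroupD(4)[OF G] U(3) V(3) inU inV) auto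
      finally show "\<exists>r>0. \<Delta> b - \<Delta> a - of_real r * u \<in> G"
        using r(1) by blast
    qed
    then show "\<exists>d>0. \<forall>a b. a \<le> x \<and> x \<le> b \<and> b - a < d \<longrightarrow> Q a b"
      using d\<^sub>1(1) d\<^sub>2(1) by (intro exI[of _ "min d\<^sub>1 d\<^sub>2"]) simp
  qed simp
  then show ?thesis
    unfolding Q_def \<Delta>_def \<sigma>\<^sub>1_def \<sigma>\<^sub>2_def u_def by simp
qed

end

section \<open>Closed Stokes trees\<close>

text \<open>Rotation of the indices: around an interior vertex every sheet in the cyclic list occurs
  once as first and once as second member of a type. Adding \<open>k\<close> before subtracting 1
  makes k - 1 the predecessor of 0 in spite of truncated subtraction.\<close>

lemma sum_cyclic_predecessor:
  fixes f :: "nat \<Rightarrow> 'b::comm_monoid_add"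
  assumes "k > 0"
  shows "(\<Sum>i<k. f ((i + k - 1) mod k)) = (\<Sum>i<k. f i)"
proof (rule sum.reindex_bij_witness[where i="\<lambda>i. Suc i mod k" and j="\<lambda>i. (i + k - 1) mod k"])
  fix i assume i: "i \<in> {..<k}"
  have pred: "(i + k - 1) mod k = (if i = 0 then k - 1 else i - 1)"
  proof (cases i)
    case (Suc j)
    have "(i + k - 1) mod k = (j + k) mod k" using Suc by simp
    then show ?thesis using i Suc by simp
  qed (use assms in simp)
  show "Suc ((i + k - 1) mod k) mod k = i" "(i + k - 1) mod k \<in> {..<k}"
    unfolding pred using i assms by auto
  show "(Suc i mod k + k - 1) mod k = i" "Suc i mod k \<in> {..<k}"
    using i assms by (cases "Suc i = k"; simp)+
qed simp

lemma closed_Stokes_treeD: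
  assumes "T \<in> closed_Stokes_trees S D L \<theta>"
  shows "finite (tree_verts T)" "finite (tree_edges T)" "tree_edges T \<noteq> {}"
    and "fst h \<in> tree_edges T \<Longrightarrow> half_start T h \<in> tree_verts T"
    and "e \<in> tree_edges T \<Longrightarrow>
      preStokes_curve S D L \<theta> (edge_path T e) (edge_sheet1 T e) (edge_sheet2 T e)"
    and "v \<in> tree_verts T \<Longrightarrow> exterior_condition S L T v \<or> interior_condition S D L T v \<and> valency T v \<ge> 3"
proof -
  have T: "finite_tree T" using assms unfolding closed_Stokes_trees_def by blast
  then show fin: "finite (tree_verts T)" "finite (tree_edges T)"
    unfolding finite_tree_def by blast+
  show "half_start T h \<in> tree_verts T" if "fst h \<in> tree_edges T"
    using that T unfolding finite_tree_def half_start_def by (simp add: image_subset_iff)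
  show "preStokes_curve S D L \<theta> (edge_path T e) (edge_sheet1 T e) (edge_sheet2 T e)"
    if "e \<in> tree_edges T"
    using that assms unfolding closed_Stokes_trees_def by blast
  have val: "valency T v = 1 \<or> valency T v \<ge> 3" if "v \<in> tree_verts T" for v
    using that T unfolding finite_tree_def by blast
  then show "exterior_condition S L T v \<or> interior_condition S D L T v \<and> valency T v \<ge> 3"
    if "v \<in> tree_verts T"
    using that assms unfolding closed_Stokes_trees_def by blast
  \<comment> \<open>Every vertex has valency 1 or at least 3, so any vertex yields an edge. This
    makes the sum of the lengths \<open>r\<close> over the edges positive in
    \<open>closed_Stokes_tree_period\<close>.\<close>
  have "tree_verts T \<noteq> {}" using T unfolding finite_tree_def connected_graph_def by blast
  then obtain v where "v \<in> tree_verts T" by blast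
  then have "half_edges_at T v \<noteq> {}" using val by fastforce
  then show "tree_edges T \<noteq> {}" unfolding half_edges_at_def by blast
qed

text \<open>At each vertex the lifts of the half-edges to their two sheets form a closed chain in \<open>L\<close>.\<close>

lemma vertex_types:
  fixes F :: "'a \<times> 'a coeffs \<Rightarrow> complex"
  assumes "exterior_condition S L T v \<or> interior_condition S D L T v \<and> valency T v \<ge> 3"
  obtains \<xi> \<eta> where
    "\<And>h. h \<in> half_edges_at T v \<Longrightarrow> type_at_start S T h (\<xi> h) (\<eta> h)"
    "\<And>h. h \<in> half_edges_at T v \<Longrightarrow> (vert_pos T v, \<xi> h) \<in> L \<and> (vert_pos T v, \<eta> h) \<in> L"
    "(\<Sum>h\<in>half_edges_at T v. F (vert_pos T v, \<eta> h) - F (vert_pos T v, \<xi> h)) = 0"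
  using assms
proof
  assume "exterior_condition S L T v"
  then obtain \<xi> where "\<And>h. h \<in> half_edges_at T v \<Longrightarrow>
      (vert_pos T v, \<xi> h) \<in> simple_branching_points S L \<and> type_at_start S T h (\<xi> h) (\<xi> h)"
    unfolding exterior_condition_def by metis
  then show thesis
    by (intro that[of \<xi> \<xi>]) (auto simp: simple_branching_points_def)
next
  assume *: "interior_condition S D L T v \<and> valency T v \<ge> 3"
  define k where "k = valency T v"
  from * obtain h s where h: "bij_betw h {..<k} (half_edges_at T v)"
    and s: "\<And>i. i < k \<Longrightarrow> (vert_pos T v, s i) \<in> L"
    and or: "(\<forall>i<k. type_at_start S T (h i) (s ((i + k - 1) mod k)) (s i)) \<or>
         (\<forall>i<k. type_at_start S T (h i) (s i) (s ((i + k - 1) mod k)))"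
    unfolding interior_condition_def Let_def k_def by blast
  have k: "k > 0" using * by (simp add: k_def)
  \<comment> \<open>Inverse of the enumeration \<open>h\<close>; it turns the sheets
    \<open>s i\<close> into functions of the half-edge.\<close>
  define n where "n = inv_into {..<k} h"
  have n: "n x < k" "h (n x) = x" if "x \<in> half_edges_at T v" for x
    using that h by (auto simp: n_def bij_betw_def inv_into_into f_inv_into_f)
       (metis inv_into_into lessThan_iff)
  have nh: "n (h i) = i" if "i < k" for i
    using that h by (simp add: n_def bij_betw_inv_into_left)
  have sum: "(\<Sum>x\<in>half_edges_at T v. F (vert_pos T v, s (f (n x)))) = (\<Sum>i<k. F (vert_pos T v, s (f i)))"
    for f
    by (subst sum.reindex_bij_betw[OF h, symmetric]) (simp add: nh)
  have mod: "(i + k - 1) mod k < k" for i using k by simp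
  have eq: "(\<Sum>x\<in>half_edges_at T v. F (vert_pos T v, s ((n x + k - 1) mod k))) =
      (\<Sum>x\<in>half_edges_at T v. F (vert_pos T v, s (n x)))"
    using sum[of "\<lambda>i. (i + k - 1) mod k"] sum[of "\<lambda>i. i"]
      sum_cyclic_predecessor[OF k, of "\<lambda>i. F (vert_pos T v, s i)"] by simp
  from or show thesis
  proof
    assume t: "\<forall>i<k. type_at_start S T (h i) (s ((i + k - 1) mod k)) (s i)"
    show thesis
    proof (rule that[of "\<lambda>x. s ((n x + k - 1) mod k)" "\<lambda>x. s (n x)"])
      show "type_at_start S T x (s ((n x + k - 1) mod k)) (s (n x))" if "x \<in> half_edges_at T v" for x
        using t n[OF that] by metis
      show "(vert_pos T v, s ((n x + k - 1) mod k)) \<in> L \<and> (vert_pos T v, s (n x)) \<in> L"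
        if "x \<in> half_edges_at T v" for x
        using s[OF mod] s[OF n(1)[OF that]] by blast
    qed (simp only: sum_subtractf eq diff_self)
  next
    assume t: "\<forall>i<k. type_at_start S T (h i) (s i) (s ((i + k - 1) mod k))"
    show thesis
    proof (rule that[of "\<lambda>x. s (n x)" "\<lambda>x. s ((n x + k - 1) mod k)"])
      show "type_at_start S T x (s (n x)) (s ((n x + k - 1) mod k))" if "x \<in> half_edges_at T v" for x
        using t n[OF that] by metis
      show "(vert_pos T v, s (n x)) \<in> L \<and> (vert_pos T v, s ((n x + k - 1) mod k)) \<in> L"
        if "x \<in> half_edges_at T v" for x
        using s[OF mod] s[OF n(1)[OF that]] by blast
    qed (simp only: sum_subtractf eq diff_self)
  qed
qed

text \<open>A backward half-edge \<open>(e, False)\<close> starts at the target of \<open>e\<close>,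
  so its type is a limit in terms of 1 - t, whereas \<open>preStokes_increment\<close> asks for a
  limit from the left at 1.\<close>

lemma limitin_reverse:
  fixes f :: "real \<Rightarrow> 'b"
  assumes "limitin X (\<lambda>t. f (1 - t)) p (at_right 0)"
  shows "limitin X f p (at_left 1)"
proof -
  have lim: "filterlim (\<lambda>t::real. 1 - t) (at_right 0) (at_left 1)"
    unfolding filterlim_at
  proof
    show "((\<lambda>t::real. 1 - t) \<longlongrightarrow> 0) (at_left 1)"
      by (rule tendsto_eq_intros refl | simp)+
    show "\<forall>\<^sub>F t in at_left 1. 1 - t \<in> {0<..} \<and> 1 - t \<noteq> (0::real)"
      unfolding eventually_at_left_field by (auto intro: exI[of _ 0])
  qed
  show ?thesis
    unfolding limitin_def
  proof (intro conjI allI impI)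
    show "p \<in> topspace X" by (rule limitin_topspace[OF assms])
    fix U assume "openin X U \<and> p \<in> U"
    then have "\<forall>\<^sub>F t in at_right 0. f (1 - t) \<in> U" using limitinD[OF assms] by blast
    from eventually_compose_filterlim[OF this lim] show "\<forall>\<^sub>F t in at_left 1. f t \<in> U" by simp
  qed
qed

context spectral_Lagrangian
begin

text \<open>Double counting over half-edges: grouped by starting vertex the terms cancel by
  \<open>vertex_types\<close>; paired by edge they are, modulo \<open>G\<close>, positive multiples
  of one and the same unit number, which cannot cancel each other.\<close>

lemma closed_Stokes_tree_period:
  assumes G: "additive_subgroup G"
    and F: "\<And>p. p \<in> L \<Longrightarrow> \<exists>U P. primitive U P \<and> p \<in> U \<and> (\<forall>q\<in>U. F q - P q \<in> G)"
    and T: "T \<in> closed_Stokes_trees S D L \<theta>"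
  shows "\<exists>r>0. of_real r * exp (2 * of_real pi * \<i> * of_real \<theta>) \<in> G"
proof -
  note t = closed_Stokes_treeD[OF T]
  define u where "u = exp (2 * complex_of_real pi * \<i> * of_real \<theta>)"
  define x where "x h = vert_pos T (half_start T h)" for h
  define ty where "ty v \<xi> \<eta> \<longleftrightarrow> (\<forall>h\<in>half_edges_at T v. type_at_start S T h (\<xi> h) (\<eta> h)) \<and>
      (\<forall>h\<in>half_edges_at T v. (vert_pos T v, \<xi> h) \<in> L \<and> (vert_pos T v, \<eta> h) \<in> L) \<and>
      (\<Sum>h\<in>half_edges_at T v. F (vert_pos T v, \<eta> h) - F (vert_pos T v, \<xi> h)) = 0" for v \<xi> \<eta>
  have "\<exists>\<xi> \<eta>. ty v \<xi> \<eta>" if v: "v \<in> tree_verts T" for v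
    unfolding ty_def by (rule vertex_types[OF t(6)[OF v], of F]) blast
  then obtain \<xi>' \<eta>' where ty: "\<And>v. v \<in> tree_verts T \<Longrightarrow> ty v (\<xi>' v) (\<eta>' v)"
    by metis
  define \<xi> where "\<xi> h = \<xi>' (half_start T h) h" for h
  define \<eta> where "\<eta> h = \<eta>' (half_start T h) h" for h
  have at: "type_at_start S T h (\<xi> h) (\<eta> h)" "(x h, \<xi> h) \<in> L" "(x h, \<eta> h) \<in> L"
    if "fst h \<in> tree_edges T" for h
  proof -
    have "h \<in> half_edges_at T (half_start T h)" using that by (simp add: half_edges_at_def)
    then show "type_at_start S T h (\<xi> h) (\<eta> h)" "(x h, \<xi> h) \<in> L" "(x h, \<eta> h) \<in> L"
      using ty[OF t(4)[OF that]] unfolding ty_def \<xi>_def \<eta>_def x_def by blast+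
  qed
  \<comment> \<open>The backward half-edge exchanges the two sheets, so
    \<open>f (e, True) + f (e, False)\<close> is the increment of \<open>F\<close> along sheet 1 of
    \<open>e\<close> minus that along sheet 2.\<close>
  define f where "f h = F (x h, \<eta> h) - F (x h, \<xi> h)" for h
  let ?H = "tree_edges T \<times> (UNIV :: bool set)"
  have "(\<Sum>h\<in>?H. f h) = (\<Sum>v\<in>tree_verts T. \<Sum>h\<in>{h. h \<in> ?H \<and> half_start T h = v}. f h)"
    using t(1,2,4) by (intro sum.group[symmetric]) auto
  also have "\<dots> = 0"
  proof (rule sum.neutral, rule ballI)
    fix v assume v: "v \<in> tree_verts T"
    have "(\<Sum>h\<in>{h. h \<in> ?H \<and> half_start T h = v}. f h) =
        (\<Sum>h\<in>half_edges_at T v. F (vert_pos T v, \<eta>' v h) - F (vert_pos T v, \<xi>' v h))"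
      by (rule sum.cong) (auto simp: half_edges_at_def f_def x_def \<xi>_def \<eta>_def)
    then show "(\<Sum>h\<in>{h. h \<in> ?H \<and> half_start T h = v}. f h) = 0" using ty[OF v] by (simp add: ty_def)
  qed
  finally have zero: "(\<Sum>e\<in>tree_edges T. f (e, True) + f (e, False)) = 0"
    by (simp add: sum.cartesian_product' UNIV_bool add.commute)
  have "\<exists>r>0. f (e, True) + f (e, False) - of_real r * u \<in> G" if e: "e \<in> tree_edges T" for e
  proof -
    have lim: "limitin (cot_top S) (\<lambda>s. (edge_path T e s, edge_sheet1 T e s)) (x (e, True), \<xi> (e, True)) (at_right 0)"
      "limitin (cot_top S) (\<lambda>s. (edge_path T e s, edge_sheet2 T e s)) (x (e, True), \<eta> (e, True)) (at_right 0)"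
      "limitin (cot_top S) (\<lambda>s. (edge_path T e (1 - s), edge_sheet2 T e (1 - s))) (x (e, False), \<xi> (e, False)) (at_right 0)"
      "limitin (cot_top S) (\<lambda>s. (edge_path T e (1 - s), edge_sheet1 T e (1 - s))) (x (e, False), \<eta> (e, False)) (at_right 0)"
      using at(1)[of "(e, True)"] at(1)[of "(e, False)"] e
      by (simp_all add: type_at_start_def half_path_def half_sheet1_def half_sheet2_def x_def)
    have "\<exists>r>0. F (x (e, False), \<eta> (e, False)) - F (x (e, False), \<xi> (e, False)) -
        (F (x (e, True), \<xi> (e, True)) - F (x (e, True), \<eta> (e, True))) - of_real r * u \<in> G"
      unfolding u_def
      by (rule preStokes_increment[OF G F t(5)[OF e] lim(1,2)
            limitin_reverse[where f="\<lambda>s. (edge_path T e s, edge_sheet1 T e s)", OF lim(4)]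
            limitin_reverse[where f="\<lambda>s. (edge_path T e s, edge_sheet2 T e s)", OF lim(3)]])
         (use at(2,3) e in auto)
    then show ?thesis by (simp add: f_def algebra_simps)
  qed
  then obtain r where r: "\<And>e. e \<in> tree_edges T \<Longrightarrow> r e > 0"
    "\<And>e. e \<in> tree_edges T \<Longrightarrow> f (e, True) + f (e, False) - of_real (r e) * u \<in> G"
    by metis
  have "(\<Sum>e\<in>tree_edges T. f (e, True) + f (e, False) - of_real (r e) * u) \<in> G"
    by (rule additive_subgroup_sum[OF G r(2)])
  moreover have "(\<Sum>e\<in>tree_edges T. f (e, True) + f (e, False) - of_real (r e) * u)
      = - (of_real (\<Sum>e\<in>tree_edges T. r e) * u)"
    using zero by (simp add: sum_subtractf sum_distrib_right)
  ultimately have "of_real (\<Sum>e\<in>tree_edges T. r e) * u \<in> G"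
    using additive_subgroupD(3)[OF G] by force
  moreover have "(\<Sum>e\<in>tree_edges T. r e) > 0"
    by (rule sum_pos[OF t(2,3) r(1)])
  ultimately show ?thesis unfolding u_def by blast
qed

end

section \<open>Density of the unobstructed angles\<close>

text \<open>The polynomial is monic of degree \<open>K\<close>: the sum starts at i = 1 and
  contributes only lower degrees.\<close>

lemma finite_monic_roots:
  fixes a :: "nat \<Rightarrow> complex"
  assumes "K > 0"
  shows "finite {\<zeta>. \<zeta> ^ K - (\<Sum>i=1..K. a i * \<zeta> ^ (K - i)) = 0}"
proof -
  define p where "p = monom 1 K - (\<Sum>i=1..K. monom (a i) (K - i))"
  have "(\<Sum>i=1..K. coeff (monom (a i) (K - i)) K) = 0"
    by (rule sum.neutral) (use assms in auto)
  then have "coeff p K = 1"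
    by (simp add: p_def coeff_sum)
  then have "p \<noteq> 0" by auto
  then have "finite {\<zeta>. poly p \<zeta> = 0}" by (rule poly_roots_finite)
  then show ?thesis by (simp add: p_def poly_monom poly_sum)
qed

lemma spectral_curve_finite_fibres:
  assumes "K > 0" "c \<in> atlas S" "x \<in> dom_of c"
  shows "finite {\<xi> c | \<xi>. (x, \<xi>) \<in> spectral_curve S D K \<Phi>}"
  by (rule finite_subset[OF _ finite_monic_roots[OF assms(1), of "\<lambda>i. \<Phi> i x c"]])
     (use assms(2,3) in \<open>unfold spectral_curve_def, blast\<close>)

section \<open>Countable sets of directions and density on the circle\<close>

abbreviation "angle \<theta> \<equiv> exp (2 * complex_of_real pi * \<i> * complex_of_real \<theta>)"

lemma sphere_eq_range_angle: "sphere 0 1 = range angle"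
proof
  show "range angle \<subseteq> sphere 0 1" by auto
  show "sphere 0 1 \<subseteq> range angle"
  proof
    fix z :: complex assume "z \<in> sphere 0 1"
    then have "norm z = 1" "z \<noteq> 0" by auto
    then have "z = exp (\<i> * of_real (Arg z))"
      using Arg_eq[of z] by simp
    then have "z = angle (Arg z / (2 * pi))" by (simp add: mult.commute)
    then show "z \<in> range angle" by blast
  qed
qed

text \<open>Each nonempty fibre of \<open>angle\<close> is contained in a translate of the
  integers.\<close>

lemma countable_vimage_angle:
  assumes "countable C"
  shows "countable (angle -` C)"
proof -
  have "countable (angle -` {angle \<theta>\<^sub>0})" for \<theta>\<^sub>0
  proof (rule countable_subset)
    show "angle -` {angle \<theta>\<^sub>0} \<subseteq> range (\<lambda>n :: int. \<theta>\<^sub>0 + of_int n)"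
    proof
      fix \<theta> assume "\<theta> \<in> angle -` {angle \<theta>\<^sub>0}"
      then obtain n :: int where "2 * complex_of_real pi * \<i> * \<theta> =
          2 * complex_of_real pi * \<i> * \<theta>\<^sub>0 + of_int (2 * n) * of_real pi * \<i>"
        by (auto simp: exp_eq)
      then have "(2 * complex_of_real pi * \<i>) * \<theta> = (2 * complex_of_real pi * \<i>) * of_real (\<theta>\<^sub>0 + of_int n)"
        by (simp add: algebra_simps)
      then have "complex_of_real \<theta> = of_real (\<theta>\<^sub>0 + of_int n)"
        by (subst (asm) mult_cancel_left) simp
      then have "\<theta> = \<theta>\<^sub>0 + of_int n" by (simp only: of_real_eq_iff)
      then show "\<theta> \<in> range (\<lambda>n :: int. \<theta>\<^sub>0 + of_int n)" by blast
    qed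
  qed simp
  then have fibre: "countable (angle -` {z})" for z
  proof (cases "z \<in> range angle")
    case False
    then have "angle -` {z} = {}" by blast
    then show ?thesis by simp
  qed blast
  have "angle -` C = (\<Union>z\<in>C. angle -` {z})" by blast
  then show ?thesis using assms fibre by simp
qed

text \<open>Density is proved on the real line, where balls are uncountable, and carried to the
  circle by the continuous map \<open>angle\<close>.\<close>

lemma sphere_subset_closure_angle:
  assumes "countable C"
  shows "sphere 0 1 \<subseteq> closure (angle ` {\<theta>. angle \<theta> \<notin> C})"
proof -
  let ?B = "angle -` C"
  have "interior ?B = {}"
  proof (rule ccontr)
    assume "interior ?B \<noteq> {}"
    then obtain x e where "e > 0" "ball x e \<subseteq> ?B" using mem_interior by blast
    then show False
      using countable_vimage_angle[OF assms] uncountable_ball countable_subset by blast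
  qed
  then have "closure (- ?B) = UNIV" by (simp add: closure_complement)
  moreover have "angle ` closure (- ?B) \<subseteq> closure (angle ` (- ?B))"
    by (rule image_closure_subset) (intro continuous_intros closed_closure closure_subset)+
  ultimately have "range angle \<subseteq> closure (angle ` (- ?B))" by simp
  moreover have "- ?B = {\<theta>. angle \<theta> \<notin> C}" by blast
  ultimately show ?thesis by (simp add: sphere_eq_range_angle)
qed

theorem theorem1p2:
  fixes S :: "'a surface" and D :: "'a set" and K :: nat
    and \<Phi> :: "nat \<Rightarrow> 'a \<Rightarrow> 'a coeffs" and L :: "('a \<times> 'a coeffs) set"
  assumes "compact_Riemann_surface S"
    and "D \<subseteq> points S" and "finite D" and "D \<noteq> {}"
    and "K > 0" and "spectral_data S D K \<Phi>"
    and "L = spectral_curve S D K \<Phi>" and "Lagrangian_submanifold S L"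
    and "strongly_GMN S D L"
  shows "closure (unobstructed_angles S D L) = sphere 0 1"
proof
  have "unobstructed_angles S D L \<subseteq> sphere 0 1"
    unfolding unobstructed_angles_def sphere_eq_range_angle by blast
  then show "closure (unobstructed_angles S D L) \<subseteq> sphere 0 1"
    by (intro closure_minimal) auto
  have S: "complex_curve S" "compact_space (surf_top S)"
    using assms(1) unfolding compact_Riemann_surface_def by blast+
  interpret spectral_Lagrangian S L
    using S(1) assms(8) spectral_curve_finite_fibres[OF assms(5)]
    by unfold_locales (simp_all add: assms(7))
  obtain G F where "countable G" and G: "additive_subgroup G"
    "\<And>p. p \<in> L \<Longrightarrow> \<exists>U P. primitive U P \<and> p \<in> U \<and> (\<forall>q\<in>U. F q - P q \<in> G)"
    using primitive_modulo_periods[OF S(2)] by metis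
  \<comment> \<open>\<open>sgn\<close> divides by the norm and so removes the unknown factor
    \<open>r\<close>. Since \<open>sgn 0 = 0\<close> lies off the circle, the zero of
    \<open>G\<close> excludes no angle.\<close>
  have "angle \<theta> \<in> sgn ` G" if "closed_Stokes_trees S D L \<theta> \<noteq> {}" for \<theta>
  proof -
    obtain r where r: "r > 0" "of_real r * angle \<theta> \<in> G"
      using closed_Stokes_tree_period[OF G] \<open>closed_Stokes_trees S D L \<theta> \<noteq> {}\<close> by blast
    have "sgn (of_real r * angle \<theta>) = angle \<theta>"
      using r(1) by (simp add: sgn_div_norm norm_mult scaleR_conv_of_real)
    then show ?thesis using r(2) by (metis imageI)
  qed
  then have "angle ` {\<theta>. angle \<theta> \<notin> sgn ` G} \<subseteq> unobstructed_angles S D L"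
    unfolding unobstructed_angles_def by blast
  then have "closure (angle ` {\<theta>. angle \<theta> \<notin> sgn ` G}) \<subseteq> closure (unobstructed_angles S D L)"
    by (rule closure_mono)
  with sphere_subset_closure_angle[OF countable_image[OF \<open>countable G\<close>]]
  show "sphere 0 1 \<subseteq> closure (unobstructed_angles S D L)" by (rule subset_trans)
qed

end
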